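(* Let $f\colon\{-1,1\}^{n^2}\to\{-1,1\}$ be given by $f(x)=\mathrm{sign}\left(1+\sum_{i=1}^n\sum_{j=1}^n 2^ix_{ij}\right)$. Then $\deg_{\pm}(f\wedge f)=\Omega(n)$.
   Context: Boolean values: $-1$ is true, $+1$ is false. $f\wedge f$ denotes the function on $\{-1,1\}^{n^2}\times\{-1,1\}^{n^2}$ given by $(x,y)\mapsto f(x)\wedge f(y)$ (two independent copies). The threshold degree $\deg_{\pm}(h)$ is the least total degree of a real polynomial $p$ with $h(z)p(z)>0$ on the domain of $h$. *)

theory Defs
  imports Complex_Main "HOL-Library.FuncSet" "HOL-Library.Poly_Mapping" "HOL-Library.Landau_Symbols"
begin

text \<open>Real polynomials in commuting indeterminates of type \<open>'v\<close>: finitely supported maps from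
  monomials, i.e. finitely supported exponent vectors, to coefficients.\<close>

type_synonym 'v real_mpoly = "('v \<Rightarrow>\<^sub>0 nat) \<Rightarrow>\<^sub>0 real"

definition mpoly_eval :: "'v real_mpoly \<Rightarrow> ('v \<Rightarrow> real) \<Rightarrow> real" where
  "mpoly_eval p z =
     (\<Sum>m\<in>Poly_Mapping.keys p.
        Poly_Mapping.lookup p m * (\<Prod>v\<in>Poly_Mapping.keys m. z v ^ Poly_Mapping.lookup m v))"

definition mpoly_vars :: "'v real_mpoly \<Rightarrow> 'v set" where
  "mpoly_vars p = (\<Union>m\<in>Poly_Mapping.keys p. Poly_Mapping.keys m)"

definition monom_degree :: "('v \<Rightarrow>\<^sub>0 nat) \<Rightarrow> nat" where
  "monom_degree m = (\<Sum>v\<in>Poly_Mapping.keys m. Poly_Mapping.lookup m v)"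

text \<open>The zero polynomial gets degree 0; it never sign-represents a function on a nonempty domain.\<close>

definition total_degree :: "'v real_mpoly \<Rightarrow> nat" where
  "total_degree p = Max (insert 0 (monom_degree ` Poly_Mapping.keys p))"

definition sign_cube :: "'v set \<Rightarrow> ('v \<Rightarrow> real) set" where
  "sign_cube I = I \<rightarrow>\<^sub>E {-1, 1}"

definition sign_represents :: "'v set \<Rightarrow> 'v real_mpoly \<Rightarrow> (('v \<Rightarrow> real) \<Rightarrow> real) \<Rightarrow> bool" where
  "sign_represents I p h \<longleftrightarrow>
     mpoly_vars p \<subseteq> I \<and> (\<forall>z\<in>sign_cube I. h z * mpoly_eval p z > 0)"

definition threshold_degree :: "'v set \<Rightarrow> (('v \<Rightarrow> real) \<Rightarrow> real) \<Rightarrow> nat" where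
  "threshold_degree I h = (LEAST d. \<exists>p. sign_represents I p h \<and> total_degree p = d)"

text \<open>Truth values are encoded as \<open>-1\<close> (true) and \<open>1\<close> (false).\<close>

definition sign_and :: "real \<Rightarrow> real \<Rightarrow> real" where
  "sign_and a b = (if a = -1 \<and> b = -1 then -1 else 1)"

text \<open>A point \<open>(x, y)\<close> of the product of two cubes is a point of the cube over the disjoint
  union of the index sets, with \<open>x = z \<circ> Inl\<close> and \<open>y = z \<circ> Inr\<close>.\<close>

definition conj_copies ::
  "(('v \<Rightarrow> real) \<Rightarrow> real) \<Rightarrow> (('w \<Rightarrow> real) \<Rightarrow> real) \<Rightarrow> ('v + 'w \<Rightarrow> real) \<Rightarrow> real" where
  "conj_copies f g z = sign_and (f (z \<circ> Inl)) (g (z \<circ> Inr))"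

definition grid :: "nat \<Rightarrow> (nat \<times> nat) set" where
  "grid n = {1..n} \<times> {1..n}"

text \<open>On the cube the argument of \<open>sgn\<close> is an odd integer, so the value is never 0.\<close>

definition halfspace :: "nat \<Rightarrow> (nat \<times> nat \<Rightarrow> real) \<Rightarrow> real" where
  "halfspace n x = sgn (1 + (\<Sum>i=1..n. \<Sum>j=1..n. 2 ^ i * x (i, j)))"

end

theory Submission
  imports Defs "HOL-Analysis.Infinite_Products" "HOL-Computational_Algebra.Polynomial"
    "HOL-Combinatorics.Permutations"
begin

text \<open>
  Averaging over suitable distributions on the cube whose weighted sum is a prescribed integer \<open>c\<close>
  turns a sign-representing polynomial of degree \<open>d\<close> for the conjunction into a function \<open>P(s, t)\<close>
  that is a polynomial of degree at most \<open>d\<close> in each variable and is negative exactly when both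
  arguments are negative, for all \<open>s, t\<close> among the points \<open>\<plusminus>81\<^sup>j\<close> (up to a factor), \<open>j \<le> 2d\<close>.
  On this set there are positive measures \<open>\<mu>, \<nu>\<close> on the positive half, with reflections \<open>\<mu>', \<nu>'\<close>,
  such that \<open>\<mu> = 2\<nu> + \<nu>'\<close> and \<open>\<mu>' = \<nu> + 2\<nu>'\<close> on polynomials of degree at most \<open>2d\<close>. Put
  \<open>a(s) = \<integral> P(s, t) d\<nu>(t)\<close> and \<open>b(s) = \<integral> P(s, t) d\<nu>'(t)\<close>. The signs of \<open>P\<close> force
  \<open>(a - b)\<^sup>2 < (a + b)\<^sup>2\<close> for \<open>s > 0\<close> and \<open>9 (a + b)\<^sup>2 < (a - b)\<^sup>2\<close> for \<open>s < 0\<close>, and integrating these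
  inequalities against the same four measures is contradictory. The points fit into the range of
  \<open>c\<close> as long as \<open>14 d < n\<close>.
\<close>

section \<open>Measures on a geometric progression and its reflection\<close>

lemma lagrange_interpolation:
  fixes a :: "nat \<Rightarrow> real"
  assumes inj: "inj_on a {..N}" and deg: "degree q \<le> N"
  shows "poly q y = (\<Sum>i\<le>N. poly q (a i) * (\<Prod>m\<in>{..N}-{i}. (y - a m) / (a i - a m)))"
proof -
  define b where "b i = (\<Prod>m\<in>{..N}-{i}. smult (1 / (a i - a m)) [:- a m, 1:])" for i
  define r where "r = (\<Sum>i\<le>N. smult (poly q (a i)) (b i))"
  have poly_b: "poly (b i) x = (\<Prod>m\<in>{..N}-{i}. (x - a m) / (a i - a m))" for i x
    by (simp add: b_def poly_prod diff_divide_distrib)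
  have deg_b: "degree (b i) \<le> N" if "i \<le> N" for i
  proof -
    have "degree (b i) \<le> (\<Sum>m\<in>{..N}-{i}. degree (smult (1 / (a i - a m)) [:- a m, 1:]))"
      unfolding b_def by (rule degree_prod_sum_le[unfolded o_def]) simp
    also have "\<dots> \<le> (\<Sum>m\<in>{..N}-{i}. 1)"
      by (intro sum_mono) (simp add: degree_smult_eq)
    also have "\<dots> = N" using that by simp
    finally show ?thesis .
  qed
  have deg_r: "degree r \<le> N"
    unfolding r_def by (intro degree_sum_le) (use deg_b in \<open>auto intro: order.trans[OF degree_smult_le]\<close>)
  have "q = r"
  proof (rule poly_eqI_degree[of "a ` {..N}"])
    fix x assume "x \<in> a ` {..N}"
    then obtain k where k: "k \<le> N" "x = a k" by auto
    have "poly (b i) (a k) = (if i = k then 1 else 0)" if "i \<le> N" for i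
    proof (cases "i = k")
      case True
      have "a k \<noteq> a m" if "m \<in> {..N} - {k}" for m
        using inj_onD[OF inj, of k m] that k by auto
      then show ?thesis using True by (simp add: poly_b)
    next
      case False
      then have "k \<in> {..N} - {i}" using k by auto
      then show ?thesis using False by (auto simp: poly_b intro: bexI[of _ k])
    qed
    then have "poly r (a k) = (\<Sum>i\<le>N. poly q (a i) * (if i = k then 1 else 0))"
      unfolding r_def by (simp add: poly_sum)
    also have "\<dots> = poly q (a k)" using k by (simp add: if_distrib cong: if_cong)
    finally show "poly q x = poly r x" using k by simp
  qed (use deg deg_r in \<open>simp_all add: card_image[OF inj]\<close>)
  then have "poly q y = poly r y" by simp
  then show ?thesis by (simp add: r_def poly_sum poly_b)
qed

section \<open>Estimates for products over the geometric nodes\<close>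

lemma sum_inj_power_le:
  fixes x :: real
  assumes "0 < x" "x < 1" and fin: "finite M" and inj: "inj_on f M" and pos: "\<And>m. m \<in> M \<Longrightarrow> 1 \<le> f m"
  shows "(\<Sum>m\<in>M. x ^ f m) \<le> x / (1 - x)"
proof -
  obtain K where K: "f ` M \<subseteq> {..K}" using finite_nat_iff_bounded_le fin by blast
  have "(\<Sum>m\<in>M. x ^ f m) = (\<Sum>k\<in>f ` M. x ^ k)" by (simp add: sum.reindex[OF inj])
  also have "\<dots> \<le> (\<Sum>k\<in>{Suc 0..<Suc K}. x ^ k)"
    using K pos assms by (intro sum_mono2) (auto simp: Suc_le_eq atMost_def less_Suc_eq_le)
  also have "\<dots> = x * (\<Sum>k\<in>{0..<K}. x ^ k)"
    by (simp add: sum.shift_bounds_Suc_ivl sum_distrib_left del: sum.op_ivl_Suc)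
  also have "\<dots> = x * ((1 - x ^ K) / (1 - x))"
    using assms sum_gp_strict[of x K] by (simp add: lessThan_atLeast0)
  also have "\<dots> \<le> x * (1 / (1 - x))"
    using assms by (intro mult_left_mono divide_right_mono) auto
  finally show ?thesis by simp
qed

text \<open>With truncated subtraction \<open>(i - m) + (m - i)\<close> is the distance |i - m|.
  Each positive distance occurs at most once on either side of \<open>i\<close>, so two geometric
  series dominate the sum.\<close>

lemma sum_power_dist_le:
  fixes x :: real and N i :: nat
  assumes "0 < x" "x < 1"
  shows "(\<Sum>m\<in>{..N}-{i}. x ^ ((i - m) + (m - i))) \<le> 2 * (x / (1 - x))"
proof -
  have "(\<Sum>m\<in>{..N}-{i}. x ^ ((i - m) + (m - i))) \<le> (\<Sum>m\<in>{..<i} \<union> {i<..N}. x ^ ((i - m) + (m - i)))"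
    using assms by (intro sum_mono2) auto
  also have "\<dots> = (\<Sum>m\<in>{..<i}. x ^ (i - m)) + (\<Sum>m\<in>{i<..N}. x ^ (m - i))"
    by (subst sum.union_disjoint) (auto intro!: arg_cong2[where f = "(+)"] sum.cong)
  also have "\<dots> \<le> x / (1 - x) + x / (1 - x)"
    using assms by (intro add_mono sum_inj_power_le) (auto simp: inj_on_def)
  finally show ?thesis by simp
qed

text \<open>Passing from \<open>j\<close> to \<open>j + 1\<close> multiplies exactly the j + 1
  factors with m \<le> j by \<open>R^2\<close>, and 2 (1 + ... + j) = j (j + 1).\<close>

lemma prod_max_powers:
  fixes R :: real
  assumes R: "1 < R" and j: "j \<le> N"
  shows "(\<Prod>m\<le>N. max ((R^2) ^ j) ((R^2) ^ m)) = R ^ (j * (j + 1)) * (\<Prod>m\<le>N. (R^2) ^ m)"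
  using j
proof (induction j)
  case 0
  have "max 1 ((R^2) ^ m) = (R^2) ^ m" for m
    using R by (simp add: max_def one_le_power)
  then show ?case by simp
next
  case (Suc j)
  have step: "max ((R^2) ^ Suc j) ((R^2) ^ m) = max ((R^2) ^ j) ((R^2) ^ m) * (if m \<le> j then R^2 else 1)" for m
  proof (cases "m \<le> j")
    case True
    then have "(R^2) ^ m \<le> (R^2) ^ j" "(R^2) ^ m \<le> (R^2) ^ Suc j"
      using R by (auto intro!: power_increasing simp del: power_Suc)
    then show ?thesis using True by (simp add: max_def)
  next
    case False
    then have "(R^2) ^ j \<le> (R^2) ^ m" "(R^2) ^ Suc j \<le> (R^2) ^ m"
      using R by (auto intro!: power_increasing simp del: power_Suc)
    then show ?thesis using False by (simp add: max_def)
  qed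
  have "(\<Prod>m\<le>N. if m \<le> j then R^2 else 1) = (\<Prod>m\<in>{..N} \<inter> {m. m \<le> j}. R^2)"
    by (subst prod.inter_restrict) auto
  also have "{..N} \<inter> {m. m \<le> j} = {..j}" using Suc.prems by auto
  finally have "(\<Prod>m\<le>N. if m \<le> j then R^2 else 1) = (R^2) ^ Suc j" by simp
  then show ?case
    unfolding step prod.distrib using Suc
    by (simp add: power_add power2_eq_square algebra_simps power_mult_distrib)
qed

lemma power_diff_dist:
  fixes T :: real
  assumes "1 < T"
  shows "\<bar>T ^ i - T ^ m\<bar> = max (T ^ i) (T ^ m) * (1 - (1/T) ^ ((i - m) + (m - i)))"
    and "T ^ i + T ^ m = max (T ^ i) (T ^ m) * (1 + (1/T) ^ ((i - m) + (m - i)))"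
proof -
  have *: "\<bar>T ^ i - T ^ m\<bar> = max (T ^ i) (T ^ m) * (1 - (1/T) ^ ((i - m) + (m - i))) \<and>
    T ^ i + T ^ m = max (T ^ i) (T ^ m) * (1 + (1/T) ^ ((i - m) + (m - i)))" if "m \<le> i" for i m
  proof -
    obtain k where k: "i = m + k" using \<open>m \<le> i\<close> le_Suc_ex by blast
    have "T ^ m \<le> T ^ i" using assms that by (simp add: power_increasing)
    moreover have "T ^ i * (1/T) ^ k = T ^ m" using assms by (simp add: k power_add power_one_over)
    ultimately show ?thesis by (simp add: k max_def algebra_simps)
  qed
  show "\<bar>T ^ i - T ^ m\<bar> = max (T ^ i) (T ^ m) * (1 - (1/T) ^ ((i - m) + (m - i)))"
    and "T ^ i + T ^ m = max (T ^ i) (T ^ m) * (1 + (1/T) ^ ((i - m) + (m - i)))"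
    using *[of m i] *[of i m] by (cases "m \<le> i"; simp add: max.commute abs_minus_commute add.commute)+
qed

text \<open>The product is at least one minus the sum of the powers, and that sum is at most 2
  (1/81) / (1 - 1/81) = 1/40.\<close>

lemma prod_one_minus_power_ge:
  fixes N i :: nat
  shows "(\<Prod>m\<in>{..N}-{i}. 1 - (1/81::real) ^ ((i - m) + (m - i))) \<ge> 39/40"
proof -
  have "(\<Prod>m\<in>{..N}-{i}. 1 - (1/81::real) ^ ((i - m) + (m - i)))
      \<ge> 1 - (\<Sum>m\<in>{..N}-{i}. (1/81) ^ ((i - m) + (m - i)))"
    by (rule Weierstrass_prod_ineq) (auto simp: power_le_one)
  then show ?thesis using sum_power_dist_le[of "1/81" i N] by simp
qed

text \<open>Since (1 + a) (1 - a) \<le> 1, the lower bound 39/40 for the product of the 1 - a turns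
  into its reciprocal here.\<close>

lemma prod_one_plus_power_le:
  fixes N i :: nat
  shows "(\<Prod>m\<in>{..N}-{i}. 1 + (1/81::real) ^ ((i - m) + (m - i))) \<le> 40/39"
proof -
  let ?a = "\<lambda>m. (1/81::real) ^ ((i - m) + (m - i))"
  have "(\<Prod>m\<in>{..N}-{i}. 1 + ?a m) * (39/40) \<le> (\<Prod>m\<in>{..N}-{i}. 1 + ?a m) * (\<Prod>m\<in>{..N}-{i}. 1 - ?a m)"
    using prod_one_minus_power_ge by (intro mult_left_mono) (auto intro!: prod_nonneg add_nonneg_nonneg)
  also have "\<dots> = (\<Prod>m\<in>{..N}-{i}. 1 - ?a m ^ 2)"
    by (simp flip: prod.distrib add: algebra_simps power2_eq_square)
  also have "\<dots> \<le> 1"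
    by (intro prod_le_1) (auto simp: power_le_one)
  finally show ?thesis by simp
qed

text \<open>Numerator and denominator are products of maxima of powers, up to corrections that cost
  at most 40/39 each. \<open>prod_max_powers\<close> evaluates the quotient of the maxima; the
  weight 9^(-j^2) cancels its quadratic growth and leaves the decay 9^(-|i - j|).\<close>

lemma lagrange_basis_at_reflection:
  fixes i j N :: nat
  assumes i: "i \<le> N" and j: "j \<le> N"
  shows "\<bar>\<Prod>m\<in>{..N}-{i}. (- (81 ^ j) - 81 ^ m) / (81 ^ i - 81 ^ m :: real)\<bar> * (1/9) ^ j\<^sup>2
      \<le> (40/39)\<^sup>2 * (if i = j then 1 else 2) * (1/9) ^ ((i - j) + (j - i)) * (1/9) ^ i\<^sup>2"
proof -
  let ?T = "81 :: real" and ?R = "9 :: real"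
  let ?G = "\<lambda>j. \<Prod>m\<in>{..N}-{i}. max (?T ^ j) (?T ^ m)"
  define k :: real where "k = (if i = j then 1 else 2)"
  have pos: "max (?T ^ a) (?T ^ b) > 0" for a b by (simp add: max_def)
  have Gpos: "?G a > 0" for a using pos by (intro prod_pos) auto
  have G: "?G a * max (?T ^ a) (?T ^ i) = ?R ^ (a * (a + 1)) * (\<Prod>m\<le>N. ?T ^ m)" if "a \<le> N" for a
    using prod_max_powers[of 9 a N] that i by (simp add: prod.remove[of "{..N}" i] mult_ac)
  have den: "(\<Prod>m\<in>{..N}-{i}. \<bar>?T ^ i - ?T ^ m\<bar>) \<ge> 39/40 * ?G i"
  proof -
    have "(\<Prod>m\<in>{..N}-{i}. \<bar>?T ^ i - ?T ^ m\<bar>) = ?G i * (\<Prod>m\<in>{..N}-{i}. 1 - (1/?T) ^ ((i - m) + (m - i)))"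
      by (simp add: power_diff_dist(1) prod.distrib)
    also have "\<dots> \<ge> ?G i * (39/40)"
      using prod_one_minus_power_ge Gpos by (intro mult_left_mono) (auto intro: less_imp_le)
    finally show ?thesis by simp
  qed
  have num: "(\<Prod>m\<in>{..N}-{i}. ?T ^ j + ?T ^ m) \<le> ?G j * (k * (40/39))"
  proof -
    let ?b = "\<lambda>m. 1 + (1/?T) ^ ((j - m) + (m - j))"
    \<comment> \<open>The source of \<open>k\<close>: if i \<noteq> j, the product contains the
      factor for m = j, which equals 2.\<close>
    have "(\<Prod>m\<in>{..N}-{i}. ?b m) \<le> k * (\<Prod>m\<in>{..N}-{j}. ?b m)"
    proof (cases "i = j")
      case False
      have "(\<Prod>m\<in>{..N}-{i}. ?b m) \<le> (\<Prod>m\<in>{..N}. ?b m)"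
        by (rule prod_mono2) auto
      also have "\<dots> = ?b j * (\<Prod>m\<in>{..N}-{j}. ?b m)"
        using j by (intro prod.remove) auto
      finally show ?thesis using False by (simp add: k_def)
    qed (simp add: k_def)
    also have "\<dots> \<le> k * (40/39)"
      using prod_one_plus_power_le[of j N] by (intro mult_left_mono) (auto simp: k_def)
    finally have "?G j * (\<Prod>m\<in>{..N}-{i}. ?b m) \<le> ?G j * (k * (40/39))"
      using Gpos by (intro mult_left_mono) (auto intro: less_imp_le)
    then show ?thesis by (simp add: power_diff_dist(2) prod.distrib)
  qed
  have "\<bar>\<Prod>m\<in>{..N}-{i}. (- (?T ^ j) - ?T ^ m) / (?T ^ i - ?T ^ m)\<bar>
      = (\<Prod>m\<in>{..N}-{i}. ?T ^ j + ?T ^ m) / (\<Prod>m\<in>{..N}-{i}. \<bar>?T ^ i - ?T ^ m\<bar>)"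
  proof -
    have "\<bar>- (?T ^ j) - ?T ^ m\<bar> = ?T ^ j + ?T ^ m" for m
      using zero_less_power[of ?T j] zero_less_power[of ?T m] by linarith
    then show ?thesis by (simp add: abs_prod prod_dividef)
  qed
  also have "\<dots> \<le> (?G j * (k * (40/39))) / (39/40 * ?G i)"
  proof (rule frac_le)
    show "0 \<le> ?G j * (k * (40/39))" using Gpos[of j] unfolding k_def by (intro mult_nonneg_nonneg) auto
    show "0 < 39/40 * ?G i" using Gpos[of i] by linarith
  qed (fact num den)+
  also have "\<dots> = (40/39)\<^sup>2 * k * (?G j / ?G i)"
    by (simp add: power2_eq_square)
  also have "?G j / ?G i = ?R ^ (j * (j + 1)) / ?R ^ (i * (i + 1)) * (?T ^ i / max (?T ^ j) (?T ^ i))"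
  proof -
    define p where "p = (\<Prod>m\<le>N. ?T ^ m)"
    have "p > 0" unfolding p_def by (rule prod_pos) simp
    have "?G j = ?R ^ (j * (j + 1)) * p / max (?T ^ j) (?T ^ i)"
      unfolding p_def by (rule eq_divide_imp[OF less_imp_neq[OF pos, symmetric] G[OF j]])
    moreover have "?G i = ?R ^ (i * (i + 1)) * p / ?T ^ i"
      using eq_divide_imp[OF less_imp_neq[OF pos, symmetric] G[OF i]] unfolding p_def max.idem .
    moreover have "(x * p / y) / (z * p / w) = x / z * (w / y)" for x y z w :: real
      using \<open>p > 0\<close> by simp
    ultimately show ?thesis by (simp only:)
  qed
  finally have "\<bar>\<Prod>m\<in>{..N}-{i}. (- (?T ^ j) - ?T ^ m) / (?T ^ i - ?T ^ m)\<bar> * (1/9) ^ j\<^sup>2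
      \<le> (40/39)\<^sup>2 * k * (?R ^ (j * (j + 1)) / ?R ^ (i * (i + 1)) * (?T ^ i / max (?T ^ j) (?T ^ i))) * (1/9) ^ j\<^sup>2"
    by (intro mult_right_mono) auto
  moreover have "?R ^ (j * (j + 1)) / ?R ^ (i * (i + 1)) * (?T ^ i / max (?T ^ j) (?T ^ i)) * (1/9) ^ j\<^sup>2
      = (1/9) ^ ((i - j) + (j - i)) * (1/9) ^ i\<^sup>2"
  proof -
    let ?e = "(i - j) + (j - i)"
    have T: "?T ^ a = ?R ^ (2 * a)" for a by (simp add: power_mult)
    have max: "max (?T ^ j) (?T ^ i) = ?R ^ (2 * max i j)"
      unfolding T by (auto simp: max_def power_increasing)
    \<comment> \<open>After cancellation this is i + j + |i - j| = 2 max(i, j).\<close>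
    have "j * (j + 1) + 2 * i + ?e + i\<^sup>2 = i * (i + 1) + 2 * max i j + j\<^sup>2"
      by (cases "i \<le> j") (auto simp: power2_eq_square max_def)
    then have eq: "?R ^ (j * (j + 1)) * ?R ^ (2 * i) * ?R ^ ?e * ?R ^ i\<^sup>2
        = ?R ^ (i * (i + 1)) * ?R ^ (2 * max i j) * ?R ^ j\<^sup>2"
      by (simp only: power_add[symmetric])
    have frac: "a / e * (b / f) * (1 / g) = 1 / c * (1 / d)"
      if "a * b * c * d = e * f * g" "0 < c" "0 < d" "0 < e" "0 < f" "0 < g" for a b c d e f g :: real
      using that by (simp add: divide_simps mult_ac)
    show ?thesis
      unfolding max unfolding T[of i] power_one_over by (rule frac[OF eq]) simp_all
  qed
  then have "(40/39)\<^sup>2 * k * (?R ^ (j * (j + 1)) / ?R ^ (i * (i + 1)) * (?T ^ i / max (?T ^ j) (?T ^ i))) * (1/9) ^ j\<^sup>2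
      = (40/39)\<^sup>2 * k * (1/9) ^ ((i - j) + (j - i)) * (1/9) ^ i\<^sup>2"
    by (simp only: mult.assoc)
  ultimately show ?thesis unfolding k_def by (simp only:)
qed

text \<open>
  The weights \<open>\<nu> j = 9 ^ (- j\<^sup>2)\<close> balance the growth of the Lagrange basis, so that Lagrange
  interpolation expresses the reflected measure by a signed measure on the positive points
  whose weights are less than \<open>2 \<nu>\<close> in absolute value.
\<close>

lemma reflected_moments:
  fixes N :: nat
  obtains \<nu> \<mu> :: "nat \<Rightarrow> real" where "\<And>j. j \<le> N \<Longrightarrow> 0 < \<nu> j" "\<And>j. j \<le> N \<Longrightarrow> 0 < \<mu> j"
    "\<And>q. degree q \<le> N \<Longrightarrow> (\<Sum>j\<le>N. \<mu> j * poly q (81 ^ j))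
       = 2 * (\<Sum>j\<le>N. \<nu> j * poly q (81 ^ j)) + (\<Sum>j\<le>N. \<nu> j * poly q (- (81 ^ j)))"
proof -
  define l :: "nat \<Rightarrow> nat \<Rightarrow> real"
    where "l i j = (\<Prod>m\<in>{..N}-{i}. (- (81 ^ j) - 81 ^ m) / (81 ^ i - 81 ^ m))" for i j
  define \<nu> :: "nat \<Rightarrow> real" where "\<nu> j = (1/9) ^ j\<^sup>2" for j
  define \<mu> where "\<mu> i = 2 * \<nu> i + (\<Sum>j\<le>N. \<nu> j * l i j)" for i
  have \<nu>: "0 < \<nu> j" for j by (simp add: \<nu>_def)
  have \<mu>: "0 < \<mu> i" if i: "i \<le> N" for i
  proof -
    let ?e = "\<lambda>j. (1/9::real) ^ ((i - j) + (j - i))"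
    have "\<bar>\<Sum>j\<le>N. \<nu> j * l i j\<bar> \<le> (\<Sum>j\<le>N. \<bar>l i j\<bar> * \<nu> j)"
      using \<nu> by (intro order.trans[OF sum_abs]) (simp add: abs_mult mult.commute less_imp_le)
    also have "\<dots> \<le> (\<Sum>j\<le>N. (40/39)\<^sup>2 * (if i = j then 1 else 2) * ?e j * \<nu> i)"
      unfolding l_def \<nu>_def using i by (intro sum_mono lagrange_basis_at_reflection) auto
    also have "\<dots> = (40/39)\<^sup>2 * \<nu> i * (\<Sum>j\<le>N. (if i = j then 1 else 2) * ?e j)"
      by (simp add: sum_distrib_left mult_ac)
    also have "(\<Sum>j\<le>N. (if i = j then 1 else 2) * ?e j) = 1 + 2 * (\<Sum>j\<in>{..N}-{i}. ?e j)"
      using i by (simp add: sum.remove[of "{..N}" i] sum_distrib_left)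
    \<comment> \<open>The powers of 1/9 add up to at most 2 (1/9) / (8/9) = 1/4. The resulting
      factor (40/39)^2 (3/2) is about 1.58, so the coefficient 2 in \<open>\<mu>\<close> keeps the
      weights positive.\<close>
    also have "(40/39)\<^sup>2 * \<nu> i * (1 + 2 * (\<Sum>j\<in>{..N}-{i}. ?e j)) \<le> (40/39)\<^sup>2 * \<nu> i * (1 + 2 * (1/4))"
      using sum_power_dist_le[of "1/9" i N] \<nu>[of i] by (intro mult_left_mono) auto
    also have "\<dots> < 2 * \<nu> i" using \<nu>[of i] by (simp add: power2_eq_square)
    finally show ?thesis unfolding \<mu>_def by linarith
  qed
  have "(\<Sum>j\<le>N. \<mu> j * poly q (81 ^ j))
       = 2 * (\<Sum>j\<le>N. \<nu> j * poly q (81 ^ j)) + (\<Sum>j\<le>N. \<nu> j * poly q (- (81 ^ j)))"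
    if q: "degree q \<le> N" for q
  proof -
    have "poly q (- (81 ^ j)) = (\<Sum>i\<le>N. poly q (81 ^ i) * l i j)" for j
      unfolding l_def using q
      by (intro lagrange_interpolation) (auto simp: inj_on_def)
    then have "(\<Sum>j\<le>N. \<nu> j * poly q (- (81 ^ j))) = (\<Sum>j\<le>N. \<Sum>i\<le>N. \<nu> j * (poly q (81 ^ i) * l i j))"
      by (simp add: sum_distrib_left)
    also have "\<dots> = (\<Sum>i\<le>N. \<Sum>j\<le>N. \<nu> j * (poly q (81 ^ i) * l i j))"
      by (rule sum.swap)
    finally show ?thesis
      by (simp add: \<mu>_def algebra_simps sum.distrib sum_distrib_left sum_distrib_right)
  qed
  with \<nu> \<mu> show ?thesis by (intro that[of \<nu> \<mu>]) auto
qed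

text \<open>\<open>F t\<close> and \<open>G s\<close> are the two one-variable sections of P. Being
  polynomial in each variable separately is enough, because every moment identity is applied in one
  variable at a time.\<close>

lemma no_bivariate_sign_representation:
  fixes F G :: "real \<Rightarrow> real poly" and d :: nat and S :: "real set"
  defines "S \<equiv> (\<lambda>j. 81 ^ j) ` {..2*d} \<union> (\<lambda>j. - (81 ^ j)) ` {..2*d}"
  assumes degF: "\<And>t. t \<in> S \<Longrightarrow> degree (F t) \<le> d"
    and degG: "\<And>s. s \<in> S \<Longrightarrow> degree (G s) \<le> d"
    and FG: "\<And>s t. s \<in> S \<Longrightarrow> t \<in> S \<Longrightarrow> poly (F t) s = poly (G s) t"
    and neg: "\<And>s t. s \<in> S \<Longrightarrow> t \<in> S \<Longrightarrow> s < 0 \<Longrightarrow> t < 0 \<Longrightarrow> poly (F t) s < 0"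
    and pos: "\<And>s t. s \<in> S \<Longrightarrow> t \<in> S \<Longrightarrow> 0 < s \<or> 0 < t \<Longrightarrow> 0 < poly (F t) s"
  shows False
proof -
  \<comment> \<open>The moment identities have to cover the squares \<open>X\<close> and
    \<open>Y\<close>, whose degree can reach 2d.\<close>
  define N where "N = 2 * d"
  obtain \<nu> \<mu> :: "nat \<Rightarrow> real" where \<nu>: "\<And>j. j \<le> N \<Longrightarrow> 0 < \<nu> j" and \<mu>: "\<And>j. j \<le> N \<Longrightarrow> 0 < \<mu> j"
    and mom: "\<And>q. degree q \<le> N \<Longrightarrow> (\<Sum>j\<le>N. \<mu> j * poly q (81 ^ j))
       = 2 * (\<Sum>j\<le>N. \<nu> j * poly q (81 ^ j)) + (\<Sum>j\<le>N. \<nu> j * poly q (- (81 ^ j)))"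
    using reflected_moments by blast
  have mom': "(\<Sum>j\<le>N. \<mu> j * poly q (- (81 ^ j)))
       = 2 * (\<Sum>j\<le>N. \<nu> j * poly q (- (81 ^ j))) + (\<Sum>j\<le>N. \<nu> j * poly q (81 ^ j))"
    if "degree q \<le> N" for q
    using mom[of "q \<circ>\<^sub>p [:0, -1:]"] that by (simp add: poly_pcompose degree_pcompose)
  have S: "81 ^ j \<in> S" "- (81 ^ j) \<in> S" if "j \<le> N" for j
    using that by (auto simp: S_def N_def)
  have sum_pos': "0 < (\<Sum>j\<le>N. w j * f j)"
    if "\<And>j. j \<le> N \<Longrightarrow> 0 < w j" "\<And>j. j \<le> N \<Longrightarrow> 0 < f j" for w f :: "nat \<Rightarrow> real"
    using that by (intro sum_pos) auto
  have sum_neg': "(\<Sum>j\<le>N. w j * f j) < 0"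
    if "\<And>j. j \<le> N \<Longrightarrow> 0 < w j" "\<And>j. j \<le> N \<Longrightarrow> f j < 0" for w f :: "nat \<Rightarrow> real"
    using sum_pos'[of w "\<lambda>j. - f j"] that by (simp add: sum_negf)
  define a where "a = (\<Sum>j\<le>N. smult (\<nu> j) (F (81 ^ j)))"
  define b where "b = (\<Sum>j\<le>N. smult (\<nu> j) (F (- (81 ^ j))))"
  have deg: "degree a \<le> d" "degree b \<le> d"
    unfolding a_def b_def using degF S
    by (auto intro!: degree_sum_le intro: order.trans[OF degree_smult_le])
  \<comment> \<open>As sums of sections \<open>F t\<close>, \<open>a\<close> and \<open>b\<close>
    are polynomials in s. On \<open>S\<close> the same values are integrals of \<open>G s\<close>
    over t, so the moment identities in t apply to them.\<close>
  have a: "poly a s = (\<Sum>j\<le>N. \<nu> j * poly (G s) (81 ^ j))"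
    and b: "poly b s = (\<Sum>j\<le>N. \<nu> j * poly (G s) (- (81 ^ j)))" if "s \<in> S" for s
    unfolding a_def b_def using that S by (auto simp: poly_sum FG intro!: sum.cong)
  have a2b: "(\<Sum>j\<le>N. \<mu> j * poly (G s) (81 ^ j)) = 2 * poly a s + poly b s"
    and b2a: "(\<Sum>j\<le>N. \<mu> j * poly (G s) (- (81 ^ j))) = 2 * poly b s + poly a s" if "s \<in> S" for s
    using mom[of "G s"] mom'[of "G s"] degG[OF that] a[OF that] b[OF that] by (auto simp: N_def)
  have G_neg: "poly (G s) (- (81 ^ j)) < 0" if "s \<in> S" "s < 0" "j \<le> N" for s j
    using neg[of s "- (81 ^ j)"] that S by (simp add: FG)
  have G_pos: "0 < poly (G s) (81 ^ j)" if "s \<in> S" "j \<le> N" for s j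
    using pos[of s "81 ^ j"] that S by (simp add: FG)
  have G_pos': "0 < poly (G s) (- (81 ^ j))" if "s \<in> S" "0 < s" "j \<le> N" for s j
    using pos[of s "- (81 ^ j)"] that S by (simp add: FG)
  define X where "X = (a + b)\<^sup>2"
  define Y where "Y = (a - b)\<^sup>2"
  have degXY: "degree X \<le> N" "degree Y \<le> N"
    using degree_power_le[of "a + b" 2] degree_power_le[of "a - b" 2]
      degree_add_le[OF deg] degree_diff_le[OF deg]
    unfolding X_def Y_def N_def by linarith+
  have XY_pos: "0 < poly X s - poly Y s" if s: "s \<in> S" "0 < s" for s
  proof -
    have "0 < poly a s" "0 < poly b s"
      unfolding a[OF s(1)] b[OF s(1)] using \<nu> G_pos G_pos' s by (intro sum_pos'; simp)+
    moreover have "poly X s - poly Y s = 4 * (poly a s * poly b s)"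
      by (simp add: X_def Y_def power2_eq_square algebra_simps)
    ultimately show ?thesis by simp
  qed
  have XY_neg: "0 < poly Y s - 9 * poly X s" if s: "s \<in> S" "s < 0" for s
  proof -
    have "0 < 2 * poly a s + poly b s"
      unfolding a2b[OF s(1), symmetric] using \<mu> G_pos s by (intro sum_pos') auto
    moreover have "2 * poly b s + poly a s < 0"
      unfolding b2a[OF s(1), symmetric] using \<mu> G_neg s by (intro sum_neg') auto
    \<comment> \<open>The factor 9 is chosen for this factorization: 2a + b and a + 2b are the
      integrals of \<open>G s\<close> against \<open>\<mu>\<close> and its reflection, and have
      opposite signs for s < 0.\<close>
    moreover have "poly Y s - 9 * poly X s = 4 * ((2 * poly a s + poly b s) * - (2 * poly b s + poly a s))"
      by (simp add: X_def Y_def power2_eq_square algebra_simps)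
    ultimately show ?thesis
      by (simp only: zero_less_mult_iff neg_0_less_iff_less) simp
  qed
  have nonneg: "0 \<le> poly X s" "0 \<le> poly Y s" for s by (auto simp: X_def Y_def)
  have strict: "0 < (\<Sum>j\<le>N. w j * (poly X (81 ^ j) - poly Y (81 ^ j)))"
    "0 < (\<Sum>j\<le>N. w j * (poly Y (- (81 ^ j)) - 9 * poly X (- (81 ^ j))))"
    if "\<And>j. j \<le> N \<Longrightarrow> 0 < w j" for w :: "nat \<Rightarrow> real"
    using that S by (auto intro!: sum_pos' XY_pos XY_neg)
  \<comment> \<open>Call these sums x, x' and y. Expanding the two strict inequalities for
    \<open>\<mu>\<close> by the moment identities, twice the first plus the second gives 5x + 16x' +
    3y < 0.\<close>
  have "0 \<le> (\<Sum>j\<le>N. \<nu> j * poly X (81 ^ j))" "0 \<le> (\<Sum>j\<le>N. \<nu> j * poly X (- (81 ^ j)))"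
    "0 \<le> (\<Sum>j\<le>N. \<nu> j * poly Y (81 ^ j))"
    using nonneg by (auto intro!: sum_nonneg mult_nonneg_nonneg less_imp_le[OF \<nu>])
  then show False
    using strict[of \<nu>, OF \<nu>] strict[of \<mu>, OF \<mu>] mom[OF degXY(1)] mom[OF degXY(2)] mom'[OF degXY(1)] mom'[OF degXY(2)]
    by (simp add: right_diff_distrib sum_subtractf mult.left_commute[of _ 9] flip: sum_distrib_left)
qed

section \<open>Characters of the cube\<close>

lemma finite_sign_cube [simp]: "finite I \<Longrightarrow> finite (sign_cube I)"
  by (simp add: sign_cube_def finite_PiE)

lemma sign_cubeD: "u \<in> sign_cube I \<Longrightarrow> j \<in> I \<Longrightarrow> u j = -1 \<or> u j = 1"
  by (auto simp: sign_cube_def PiE_iff)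

lemma sign_cube_square: "u \<in> sign_cube I \<Longrightarrow> j \<in> I \<Longrightarrow> u j * u j = 1"
  by (drule (1) sign_cubeD) auto

lemma sign_cube_mult_prod:
  assumes "u \<in> sign_cube I" "finite I" "C \<subseteq> I" "j \<in> I"
  shows "u j * prod u C = prod u (if j \<in> C then C - {j} else insert j C)"
proof -
  have "finite C" using assms finite_subset by auto
  then show ?thesis
    using sign_cube_square[OF assms(1,4)] by (auto simp: prod.remove[of C j] simp flip: mult.assoc)
qed

lemma sum_character_eq_0:
  fixes C :: "'v set"
  assumes "finite I" "C \<subseteq> I" "C \<noteq> {}"
  shows "(\<Sum>u\<in>sign_cube I. prod u C) = 0"
proof -
  have "prod u C = (\<Prod>j\<in>I. if j \<in> C then u j else 1)" for u :: "'v \<Rightarrow> real"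
    using assms by (simp add: prod.If_cases Int_absorb1)
  then have "(\<Sum>u\<in>sign_cube I. prod u C) = (\<Prod>j\<in>I. \<Sum>y\<in>{-1,1::real}. if j \<in> C then y else 1)"
    unfolding sign_cube_def using assms by (subst prod_sum_PiE) auto
  also have "\<dots> = 0"
    using assms by (auto intro!: prod_zero)
  finally show ?thesis .
qed

text \<open>Multiplying by one coordinate toggles one element of \<open>C\<close>, so each factor
  \<open>sum u I\<close> lowers the size of a character by at most one. After k < card C factors
  only nontrivial characters occur.\<close>

lemma sum_character_power_eq_0:
  assumes "finite I" "C \<subseteq> I" "k < card C"
  shows "(\<Sum>u\<in>sign_cube I. prod u C * sum u I ^ k) = 0"
  using assms(2,3)
proof (induction k arbitrary: C)
  case 0
  then have "C \<noteq> {}" by auto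
  then show ?case using sum_character_eq_0[OF assms(1) 0(1)] by simp
next
  case (Suc k)
  let ?D = "\<lambda>j. if j \<in> C then C - {j} else insert j C"
  have finC: "finite C" using Suc.prems assms finite_subset by auto
  have D: "(\<Sum>u\<in>sign_cube I. prod u (?D j) * sum u I ^ k) = 0" if "j \<in> I" for j
  proof (rule Suc.IH)
    show "?D j \<subseteq> I" using that Suc.prems by auto
    show "k < card (?D j)" using Suc.prems finC by auto
  qed
  have "prod u C * sum u I ^ Suc k = (\<Sum>j\<in>I. prod u (?D j) * sum u I ^ k)" if "u \<in> sign_cube I" for u
  proof -
    have "prod u C * sum u I ^ Suc k = (\<Sum>j\<in>I. (u j * prod u C) * sum u I ^ k)"
      by (simp add: sum_distrib_left sum_distrib_right mult_ac)
    then show ?thesis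
      using that assms Suc.prems by (simp only: sign_cube_mult_prod cong: sum.cong)
  qed
  then have "(\<Sum>u\<in>sign_cube I. prod u C * sum u I ^ Suc k)
      = (\<Sum>u\<in>sign_cube I. \<Sum>j\<in>I. prod u (?D j) * sum u I ^ k)" by (rule sum.cong[OF refl])
  also have "\<dots> = (\<Sum>j\<in>I. \<Sum>u\<in>sign_cube I. prod u (?D j) * sum u I ^ k)" by (rule sum.swap)
  also have "\<dots> = 0" using D by (intro sum.neutral) auto
  finally show ?case .
qed

lemma sum_character_poly_eq_0:
  assumes "finite I" "C \<subseteq> I" "degree q < card C"
  shows "(\<Sum>u\<in>sign_cube I. prod u C * poly q (sum u I)) = 0"
proof -
  have "(\<Sum>u\<in>sign_cube I. prod u C * poly q (sum u I))
      = (\<Sum>u\<in>sign_cube I. \<Sum>k\<le>degree q. coeff q k * (prod u C * sum u I ^ k))"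
    by (simp add: poly_altdef sum_distrib_left mult_ac)
  also have "\<dots> = (\<Sum>k\<le>degree q. coeff q k * (\<Sum>u\<in>sign_cube I. prod u C * sum u I ^ k))"
    unfolding sum_distrib_left by (rule sum.swap)
  also have "\<dots> = 0"
    using assms by (intro sum.neutral) (auto simp: sum_character_power_eq_0)
  finally show ?thesis .
qed

text \<open>Flipping one sign changes the sum by 2 modulo 4 and negates the product, so the product
  determines the sum modulo 4.\<close>

lemma sum_signs_mod_4:
  fixes u :: "'v \<Rightarrow> real"
  assumes "finite I" "\<And>j. j \<in> I \<Longrightarrow> u j = -1 \<or> u j = 1"
  shows "(prod u I = -1 \<or> prod u I = 1) \<and> (\<exists>k::int. sum u I = real (card I) - 1 + prod u I + 4 * of_int k)"
  using assms
proof (induction I rule: finite_induct)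
  case empty
  show ?case by (auto intro: exI[of _ 0])
next
  case (insert j I)
  from insert.IH insert.prems obtain k :: int
    where P: "prod u I = -1 \<or> prod u I = 1" and k: "sum u I = real (card I) - 1 + prod u I + 4 * of_int k"
    by auto
  from insert.prems[of j] P show ?case
    using insert.hyps k by (auto intro: exI[of _ k] exI[of _ "k-1"] exI[of _ "k+1"])
qed

section \<open>Characters averaged over slices of constant coordinate sum\<close>

definition cube_slice :: "nat \<Rightarrow> real \<Rightarrow> (nat \<Rightarrow> real) set" where
  "cube_slice n c = {u \<in> sign_cube {1..n}. sum u {1..n} = c}"

lemma finite_cube_slice [simp]: "finite (cube_slice n c)"
  by (simp add: cube_slice_def)

text \<open>Transposing the coordinates \<open>j\<close> and \<open>l\<close> permutes the slice and
  fixes the part of the character on \<open>C\<close>.\<close>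

lemma cube_slice_swap:
  assumes "j \<in> {1..n} - C" "l \<in> {1..n} - C" "C \<subseteq> {1..n}"
  shows "(\<Sum>u\<in>cube_slice n c. prod u (insert j C)) = (\<Sum>u\<in>cube_slice n c. prod u (insert l C))"
proof -
  let ?p = "Transposition.transpose j l"
  have "finite C" using assms finite_subset by auto
  have perm: "?p permutes {1..n}" using assms by (intro permutes_swap_id) auto
  have mem: "u \<circ> ?p \<in> cube_slice n c" if "u \<in> cube_slice n c" for u
  proof -
    have "sum (u \<circ> ?p) {1..n} = sum u {1..n}"
      using perm by (metis sum.permute)
    moreover have "u \<circ> ?p \<in> sign_cube {1..n}"
      using that assms permutes_in_image[OF perm] permutes_not_in[OF perm]
      by (auto simp: cube_slice_def sign_cube_def PiE_iff extensional_def)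
    ultimately show ?thesis using that by (simp add: cube_slice_def)
  qed
  show ?thesis
  proof (rule sum.reindex_bij_witness[where i = "\<lambda>u. u \<circ> ?p" and j = "\<lambda>u. u \<circ> ?p"])
    fix u assume "u \<in> cube_slice n c"
    have "prod (u \<circ> ?p) C = prod u C"
      using assms by (intro prod.cong) (auto simp: Transposition.transpose_def)
    then show "prod (u \<circ> ?p) (insert l C) = prod u (insert j C)"
      using assms \<open>finite C\<close> by simp
  qed (use mem in \<open>auto simp: o_assoc[symmetric]\<close>)
qed

text \<open>
  On the slice, multiplying a character by the coordinate sum \<open>c\<close> gives a three-term recurrence in the
  size of \<open>B\<close>, because by symmetry the sum depends on the size only.
\<close>

lemma cube_slice_character_poly:
  assumes "k \<le> n"
  shows "\<exists>K. degree K \<le> k \<and> (\<forall>c B. B \<subseteq> {1..n} \<and> card B = k \<longrightarrow>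
    (\<Sum>u\<in>cube_slice n c. prod u B) = poly K c * card (cube_slice n c))"
  using assms
proof (induction k rule: less_induct)
  case (less k)
  show ?case
  proof (cases k)
    case 0
    show ?thesis
    proof (intro exI[of _ 1] conjI allI impI)
      fix c B assume "B \<subseteq> {1..n} \<and> card B = k"
      then have "B = {}" using 0 finite_subset[of B "{1..n}"] by auto
      then show "(\<Sum>u\<in>cube_slice n c. prod u B) = poly 1 c * card (cube_slice n c)" by simp
    qed simp
  next
    case (Suc k')
    from less.IH[of k'] less.prems Suc obtain K where K: "degree K \<le> k'"
      "\<And>c B. B \<subseteq> {1..n} \<Longrightarrow> card B = k' \<Longrightarrow> (\<Sum>u\<in>cube_slice n c. prod u B) = poly K c * card (cube_slice n c)"
      by auto
    obtain L where L: "degree L \<le> k'"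
      "\<And>c B. B \<subseteq> {1..n} \<Longrightarrow> card B = k' \<Longrightarrow>
        (\<Sum>j\<in>B. \<Sum>u\<in>cube_slice n c. prod u (B - {j})) = poly L c * card (cube_slice n c)"
    proof (cases k')
      case 0
      show ?thesis
      proof (rule that[of 0])
        fix c B assume "B \<subseteq> {1..n}" "card B = k'"
        then have "B = {}" using 0 finite_subset[of B "{1..n}"] by auto
        then show "(\<Sum>j\<in>B. \<Sum>u\<in>cube_slice n c. prod u (B - {j})) = poly 0 c * card (cube_slice n c)" by simp
      qed simp
    next
      case (Suc k'')
      from less.IH[of k''] less.prems Suc \<open>k = Suc k'\<close> obtain K' where K': "degree K' \<le> k''"
        "\<And>c B. B \<subseteq> {1..n} \<Longrightarrow> card B = k'' \<Longrightarrow> (\<Sum>u\<in>cube_slice n c. prod u B) = poly K' c * card (cube_slice n c)"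
        by auto
      show ?thesis
      proof (rule that[of "smult (of_nat k') K'"])
        show "degree (smult (of_nat k') K') \<le> k'" using K'(1) Suc degree_smult_le[of "of_nat k'" K'] by linarith
        fix c B assume B: "B \<subseteq> {1..n}" "card B = k'"
        have "(\<Sum>u\<in>cube_slice n c. prod u (B - {j})) = poly K' c * card (cube_slice n c)" if "j \<in> B" for j
          using B Suc that by (intro K'(2)) auto
        then show "(\<Sum>j\<in>B. \<Sum>u\<in>cube_slice n c. prod u (B - {j})) = poly (smult (of_nat k') K') c * card (cube_slice n c)"
          using B by simp
      qed
    qed
    have nk: "real n - real k' > 0" using less.prems Suc by simp
    \<comment> \<open>The recurrence c K = L + (n - k') M solved for M: \<open>L\<close> collects
      the k' ways to delete an element, and each of the n - k' ways to insert one contributes the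
      same sum.\<close>
    define M where "M = smult (1 / (real n - real k')) ([:0, 1:] * K - L)"
    have "degree ([:0, 1:] * K - L) \<le> k"
      using K(1) L(1) Suc degree_mult_le[of "[:0,1:]" K] by (intro degree_diff_le) auto
    then have "degree M \<le> k" unfolding M_def by (rule order.trans[OF degree_smult_le])
    moreover have "(\<Sum>u\<in>cube_slice n c. prod u B) = poly M c * card (cube_slice n c)"
      if B: "B \<subseteq> {1..n}" "card B = k" for c B
    proof -
      have finB: "finite B" using B finite_subset by auto
      obtain l where l: "l \<in> B" using B Suc by fastforce
      define C where "C = B - {l}"
      have C: "C \<subseteq> {1..n}" "card C = k'" "finite C" "l \<in> {1..n} - C" "B = insert l C"
        using B l Suc finB by (auto simp: C_def)
      have "c * (poly K c * card (cube_slice n c)) = (\<Sum>u\<in>cube_slice n c. sum u {1..n} * prod u C)"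
        unfolding K(2)[OF C(1,2), symmetric] sum_distrib_left by (intro sum.cong) (auto simp: cube_slice_def)
      also have "\<dots> = (\<Sum>u\<in>cube_slice n c. \<Sum>j\<in>{1..n}. u j * prod u C)"
        by (simp add: sum_distrib_right)
      also have "\<dots> = (\<Sum>u\<in>cube_slice n c. \<Sum>j\<in>{1..n}. prod u (if j \<in> C then C - {j} else insert j C))"
        using C by (intro sum.cong refl sign_cube_mult_prod) (auto simp: cube_slice_def)
      also have "\<dots> = (\<Sum>j\<in>{1..n}. \<Sum>u\<in>cube_slice n c. prod u (if j \<in> C then C - {j} else insert j C))"
        by (rule sum.swap)
      also have "\<dots> = (\<Sum>j\<in>C. \<Sum>u\<in>cube_slice n c. prod u (C - {j}))
          + (\<Sum>j\<in>{1..n} - C. \<Sum>u\<in>cube_slice n c. prod u (insert j C))"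
        by (subst sum.subset_diff[OF C(1)]) auto
      also have "(\<Sum>j\<in>{1..n} - C. \<Sum>u\<in>cube_slice n c. prod u (insert j C))
          = (\<Sum>j\<in>{1..n} - C. \<Sum>u\<in>cube_slice n c. prod u B)"
        unfolding C(5) using C by (intro sum.cong refl cube_slice_swap) auto
      also have "\<dots> = (real n - real k') * (\<Sum>u\<in>cube_slice n c. prod u B)"
        using C less.prems Suc by (simp add: card_Diff_subset of_nat_diff)
      also have "(\<Sum>j\<in>C. \<Sum>u\<in>cube_slice n c. prod u (C - {j})) = poly L c * card (cube_slice n c)"
        using C by (intro L(2))
      finally show ?thesis using nk by (simp add: M_def field_simps)
    qed
    ultimately show ?thesis by blast
  qed
qed

section \<open>Averages with a prescribed weighted sum\<close>

text \<open>
  Only the first \<open>n - 2\<close> columns of the rows below the top one vary; the last two cancel. This keeps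
  the carry into the top row within its range.
\<close>

definition balanced_row :: "nat \<Rightarrow> (nat \<Rightarrow> real) \<Rightarrow> nat \<Rightarrow> real" where
  "balanced_row n u = (\<lambda>j\<in>{1..n}. if j \<le> n - 2 then u j else if j = n then -1 else 1)"

text \<open>
  The product of the free entries of a row determines its sum modulo 4. Requiring this product to be
  \<open>row_sign n c\<close> makes the carry \<open>(c - sum) / 2\<close> an integer of the parity of \<open>n\<close>.
\<close>

definition row_sign :: "nat \<Rightarrow> real \<Rightarrow> real" where
  "row_sign n c = (if \<exists>k::int. c = 3 * real n - 2 + 4 * of_int k then 1 else -1)"

text \<open>
  Rows \<open>n - r, \<dots>, n\<close> are filled so that their sums, weighted by \<open>1, 2, 4, \<dots>, 2 ^ r\<close>, add up to \<open>c\<close>.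
  The parity condition on a row is invisible to polynomials of degree less than \<open>n - 2\<close>, hence
  characters of small degree average to polynomials in \<open>c\<close>. The base function \<open>\<lambda>_. u\<close> is a
  placeholder outside row \<open>n\<close>; the recursion overwrites the other rows.
\<close>

primrec row_sum :: "nat \<Rightarrow> nat \<Rightarrow> real \<Rightarrow> ((nat \<Rightarrow> nat \<Rightarrow> real) \<Rightarrow> real) \<Rightarrow> real" where
  "row_sum n 0 c F = (\<Sum>u\<in>cube_slice n c. F (\<lambda>_. u)) / card (cube_slice n c)"
| "row_sum n (Suc r) c F = (\<Sum>u\<in>sign_cube {1..n-2}. (1 + row_sign n c * prod u {1..n-2}) *
      row_sum n r ((c - sum u {1..n-2}) / 2) (\<lambda>x. F (x(n - Suc r := balanced_row n u))))"

text \<open>The bound is stable under the recursion: if |S| \<le> n - 2, then |c - S| / 2 satisfies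
  it for \<open>r\<close> whenever |c| does for r + 1. At r = 0 it reads |c| \<le> n, and with the
  parity condition this makes the slice nonempty.\<close>

definition reachable :: "nat \<Rightarrow> nat \<Rightarrow> real \<Rightarrow> bool" where
  "reachable n r c \<longleftrightarrow> (\<exists>k::int. c = real n + 2 * of_int k) \<and> \<bar>c\<bar> \<le> 2 ^ (r + 1) + real n - 2"

definition row_config :: "nat \<Rightarrow> nat \<Rightarrow> real \<Rightarrow> (nat \<Rightarrow> nat \<Rightarrow> real) \<Rightarrow> bool" where
  "row_config n r c x \<longleftrightarrow> (\<forall>i\<in>{n-r..n}. x i \<in> sign_cube {1..n}) \<and>
     (\<Sum>i=n-r..n. 2 ^ (i - (n - r)) * sum (x i) {1..n}) = c"

lemma row_sum_linear:
  "row_sum n r c (\<lambda>x. \<Sum>a\<in>A. g a * F a x) = (\<Sum>a\<in>A. g a * row_sum n r c (F a))"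
proof (induction r arbitrary: c F)
  case 0
  have "(\<Sum>u\<in>cube_slice n c. \<Sum>a\<in>A. g a * F a (\<lambda>_. u)) = (\<Sum>a\<in>A. g a * (\<Sum>u\<in>cube_slice n c. F a (\<lambda>_. u)))"
    unfolding sum_distrib_left by (rule sum.swap)
  then show ?case by (simp only: row_sum.simps sum_divide_distrib[of _ A] times_divide_eq_right)
next
  case (Suc r)
  let ?w = "\<lambda>u. 1 + row_sign n c * prod u {1..n-2}"
  let ?G = "\<lambda>a u. row_sum n r ((c - sum u {1..n-2}) / 2) (\<lambda>x. F a (x(n - Suc r := balanced_row n u)))"
  have "(\<Sum>u\<in>sign_cube {1..n-2}. \<Sum>a\<in>A. g a * (?w u * ?G a u)) = (\<Sum>a\<in>A. \<Sum>u\<in>sign_cube {1..n-2}. g a * (?w u * ?G a u))"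
    by (rule sum.swap)
  then show ?case
    by (simp only: row_sum.simps Suc sum_distrib_left mult.left_commute[of "g _"])
qed

lemma row_sum_mult: "row_sum n r c (\<lambda>x. a * F x) = a * row_sum n r c F"
  using row_sum_linear[where A = "{()}" and g = "\<lambda>_. a" and F = "\<lambda>_. F"] by simp

lemma interval_split2: "n \<ge> 2 \<Longrightarrow> {1..n} = insert n (insert (n-1) {1..n-2})" for n :: nat
  by auto

lemma balanced_row:
  assumes "n \<ge> 3" "u \<in> sign_cube {1..n-2}"
  shows "balanced_row n u \<in> sign_cube {1..n}" and "sum (balanced_row n u) {1..n} = sum u {1..n-2}"
proof -
  show "balanced_row n u \<in> sign_cube {1..n}"
    using assms by (auto simp: balanced_row_def sign_cube_def PiE_iff)
  have "sum (balanced_row n u) {1..n-2} = sum u {1..n-2}"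
    by (intro sum.cong) (auto simp: balanced_row_def)
  moreover have "n \<notin> insert (n-1) {1..n-2}" "n - 1 \<notin> {1..n-2}" using assms by auto
  moreover have "balanced_row n u n = -1" "balanced_row n u (n-1) = 1"
    using assms by (auto simp: balanced_row_def)
  ultimately show "sum (balanced_row n u) {1..n} = sum u {1..n-2}"
    using assms interval_split2[of n] by simp
qed

lemma prod_balanced_row:
  assumes "B \<subseteq> {1..n}"
  obtains s :: real where "\<And>u. prod (balanced_row n u) B = s * prod u (B \<inter> {1..n-2})"
proof
  fix u :: "nat \<Rightarrow> real"
  have fin: "finite B" using assms finite_subset by auto
  have "prod (balanced_row n u) B = prod (balanced_row n u) (B - B \<inter> {1..n-2}) * prod (balanced_row n u) (B \<inter> {1..n-2})"
    using fin by (intro prod.subset_diff) auto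
  also have "prod (balanced_row n u) (B \<inter> {1..n-2}) = prod u (B \<inter> {1..n-2})"
    by (intro prod.cong) (auto simp: balanced_row_def)
  also have "prod (balanced_row n u) (B - B \<inter> {1..n-2}) = (\<Prod>j\<in>B - B \<inter> {1..n-2}. if j = n then -1 else 1)"
    using assms by (intro prod.cong) (auto simp: balanced_row_def)
  finally show "prod (balanced_row n u) B = (\<Prod>j\<in>B - B \<inter> {1..n-2}. if j = n then -1 else 1) * prod u (B \<inter> {1..n-2})" .
qed

lemma row_sign_cases: "row_sign n c = -1 \<or> row_sign n c = 1"
  by (simp add: row_sign_def)

text \<open>The weight is 0 or 2. In the latter case the product of the row is
  \<open>row_sign n c\<close>, which fixes the row sum modulo 4 and hence the parity of the carry;
  the size bound holds since at most n - 2 entries are summed.\<close>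

lemma row_weight:
  assumes n: "n \<ge> 3" and c: "reachable n (Suc r) c" and u: "u \<in> sign_cube {1..n-2}"
  shows "1 + row_sign n c * prod u {1..n-2} = 0 \<or>
    (0 < 1 + row_sign n c * prod u {1..n-2} \<and> reachable n r ((c - sum u {1..n-2}) / 2))"
proof -
  let ?p = "prod u {1..n-2}" and ?S = "sum u {1..n-2}"
  obtain k :: int where p: "?p = -1 \<or> ?p = 1" and k: "?S = real (n - 2) - 1 + ?p + 4 * of_int k"
    using sum_signs_mod_4[of "{1..n-2}" u] sign_cubeD[OF u] by auto
  have k: "?S = real n - 3 + ?p + 4 * of_int k" using k n by (simp add: of_nat_diff)
  have "\<bar>?S\<bar> \<le> (\<Sum>j\<in>{1..n-2}. 1)"
    using sign_cubeD[OF u] by (intro order.trans[OF sum_abs] sum_mono) force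
  then have "\<bar>?S\<bar> \<le> real n - 2" using n by (simp add: of_nat_diff)
  moreover from c obtain l :: int where l: "c = real n + 2 * of_int l" and cb: "\<bar>c\<bar> \<le> 2 ^ (Suc r + 1) + real n - 2"
    by (auto simp: reachable_def)
  ultimately have bound: "\<bar>(c - ?S) / 2\<bar> \<le> 2 ^ (r + 1) + real n - 2" by simp
  consider "row_sign n c \<noteq> ?p" | "row_sign n c = ?p" by blast
  then show ?thesis
  proof cases
    case 1
    then show ?thesis using p row_sign_cases[of n c] by auto
  next
    case 2
    have "\<exists>m::int. (c - ?S) / 2 = real n + 2 * of_int m"
    proof (cases "?p = 1")
      case True
      then obtain m :: int where "c = 3 * real n - 2 + 4 * of_int m"
        using 2 by (auto simp: row_sign_def split: if_splits)
      then show ?thesis using k True by (intro exI[of _ "m - k"]) (simp add: field_simps)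
    next
      case False
      with p have p': "?p = -1" by simp
      \<comment> \<open>Both c and 3n - 2 have the parity of n. As \<open>row_sign\<close> is -1
        they differ modulo 4, so c is congruent to 3n.\<close>
      have "odd (l - int n + 1)"
      proof
        assume "even (l - int n + 1)"
        then obtain m where "l - int n + 1 = 2 * m" by blast
        then have "l = int n - 1 + 2 * m" by simp
        then have "c = 3 * real n - 2 + 4 * of_int m" unfolding l by simp
        then show False using 2 p' by (auto simp: row_sign_def split: if_splits)
      qed
      then obtain m where "l - int n + 1 = 2 * m + 1" by (rule oddE)
      then have "l = int n + 2 * m" by simp
      then have "c = 3 * real n + 4 * of_int m" unfolding l by simp
      then show ?thesis using k p' by (intro exI[of _ "m - k + 1"]) (simp add: field_simps)
    qed
    then show ?thesis using 2 p bound by (auto simp: reachable_def)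
  qed
qed

text \<open>Placing a row below the others doubles their weights, so the new weighted sum is the row
  sum plus twice the carry.\<close>

lemma row_config_update:
  assumes n: "n \<ge> 3" and r: "Suc r \<le> n" and u: "u \<in> sign_cube {1..n-2}"
    and x: "row_config n r ((c - sum u {1..n-2}) / 2) x"
  shows "row_config n (Suc r) c (x(n - Suc r := balanced_row n u))"
proof -
  define k where "k = n - Suc r"
  have k: "n - r = Suc k" "k \<le> n" using r by (auto simp: k_def)
  have int: "{k..n} = insert k {Suc k..n}" using k by auto
  have "(\<Sum>i\<in>{Suc k..n}. 2 ^ (i - k) * sum ((x(k := balanced_row n u)) i) {1..n})
      = (\<Sum>i\<in>{Suc k..n}. 2 * (2 ^ (i - Suc k) * sum (x i) {1..n}))"
  proof (intro sum.cong refl)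
    fix i assume "i \<in> {Suc k..n}"
    then have "i - k = Suc (i - Suc k)" "i \<noteq> k" by auto
    then show "2 ^ (i - k) * sum ((x(k := balanced_row n u)) i) {1..n} = 2 * (2 ^ (i - Suc k) * sum (x i) {1..n})"
      by simp
  qed
  also have "\<dots> = 2 * (\<Sum>i\<in>{Suc k..n}. 2 ^ (i - Suc k) * sum (x i) {1..n})"
    by (rule sum_distrib_left[symmetric])
  finally have "(\<Sum>i\<in>{k..n}. 2 ^ (i - k) * sum ((x(k := balanced_row n u)) i) {1..n}) = c"
    using x balanced_row(2)[OF n u] unfolding row_config_def k int by simp
  then show ?thesis
    using x balanced_row(1)[OF n u] unfolding row_config_def k k_def[symmetric] int by auto
qed

lemma cube_slice_nonempty:
  assumes "reachable n 0 c"
  shows "cube_slice n c \<noteq> {}"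
proof -
  obtain k :: int where k: "c = real n + 2 * of_int k" and c: "\<bar>c\<bar> \<le> real n"
    using assms by (auto simp: reachable_def)
  \<comment> \<open>A point with p entries equal to -1 has coordinate sum n - 2p.\<close>
  define p where "p = nat (- k)"
  have "k \<le> 0" "- k \<le> int n" using k c by linarith+
  then have p: "p \<le> n" "real_of_int k = - real p" by (auto simp: p_def)
  define u :: "nat \<Rightarrow> real" where "u = (\<lambda>j\<in>{1..n}. if j \<le> p then -1 else 1)"
  have "sum u {1..n} = (\<Sum>j\<in>{1..n}. (if j \<le> p then -1 else 1))"
    by (simp add: u_def)
  also have "\<dots> = (\<Sum>j\<in>{1..n}. 1 - 2 * (if j \<le> p then 1 else 0))"
    by (intro sum.cong) auto
  also have "\<dots> = real n - 2 * (\<Sum>j\<in>{1..n}. (if j \<le> p then 1 else 0))"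
    by (simp add: sum_subtractf sum_distrib_left)
  also have "(\<Sum>j\<in>{1..n}. (if j \<le> p then 1 else 0)) = (\<Sum>j\<in>{1..n} \<inter> {j. j \<le> p}. (1::real))"
    by (subst sum.inter_restrict) auto
  also have "{1..n} \<inter> {j. j \<le> p} = {1..p}" using p by auto
  finally have "sum u {1..n} = c" using k p by simp
  moreover have "u \<in> sign_cube {1..n}" by (auto simp: u_def sign_cube_def)
  ultimately show ?thesis by (auto simp: cube_slice_def)
qed

lemma row_sum_pos:
  assumes n: "n \<ge> 3" and "r < n" "reachable n r c"
    and "\<And>x. row_config n r c x \<Longrightarrow> 0 < F x"
  shows "0 < row_sum n r c F"
  using assms(2-)
proof (induction r arbitrary: c F)
  case 0
  have "0 < F (\<lambda>_. u)" if "u \<in> cube_slice n c" for u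
    using that by (intro 0) (auto simp: row_config_def cube_slice_def)
  then show ?case
    using cube_slice_nonempty[OF 0(2)] by (auto intro!: divide_pos_pos sum_pos simp: card_gt_0_iff)
next
  case (Suc r)
  let ?t = "\<lambda>u. (1 + row_sign n c * prod u {1..n-2}) *
      row_sum n r ((c - sum u {1..n-2}) / 2) (\<lambda>x. F (x(n - Suc r := balanced_row n u)))"
  have t: "?t u \<ge> 0 \<and> (1 + row_sign n c * prod u {1..n-2} \<noteq> 0 \<longrightarrow> ?t u > 0)" if u: "u \<in> sign_cube {1..n-2}" for u
  proof (cases "1 + row_sign n c * prod u {1..n-2} = 0")
    case False
    then have w: "0 < 1 + row_sign n c * prod u {1..n-2}" "reachable n r ((c - sum u {1..n-2}) / 2)"
      using row_weight[OF n Suc.prems(2) u] by auto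
    have "0 < row_sum n r ((c - sum u {1..n-2}) / 2) (\<lambda>x. F (x(n - Suc r := balanced_row n u)))"
      using Suc.prems w u n by (intro Suc.IH Suc.prems row_config_update) auto
    then show ?thesis using w(1) by (simp add: less_imp_le)
  qed simp
  \<comment> \<open>A row of positive weight: its product is its first entry, which is set to
    \<open>row_sign n c\<close>.\<close>
  define v where "v = (\<lambda>j\<in>{1..n-2}. if j = 1 then row_sign n c else 1)"
  have v: "v \<in> sign_cube {1..n-2}"
    using row_sign_cases[of n c] by (auto simp: v_def sign_cube_def)
  have "prod v {1..n-2} = row_sign n c"
    using n by (simp add: v_def)
  then have "1 + row_sign n c * prod v {1..n-2} \<noteq> 0" using row_sign_cases[of n c] by auto
  then have "0 < (\<Sum>u\<in>sign_cube {1..n-2}. ?t u)"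
    using t v by (intro sum_pos2[of _ v]) auto
  then show ?case by simp
qed

lemma row_sum_character_poly:
  assumes n: "n \<ge> 3" and "r < n" "\<And>i. B i \<subseteq> {1..n}" "(\<Sum>i=n-r..n. card (B i)) < n - 2"
  shows "\<exists>Q. degree Q \<le> (\<Sum>i=n-r..n. card (B i)) \<and> (\<forall>c. reachable n r c \<longrightarrow>
    row_sum n r c (\<lambda>x. \<Prod>i=n-r..n. prod (x i) (B i)) = poly Q c)"
  using assms(2-)
proof (induction r)
  case 0
  have "card (B n) \<le> n" using card_mono[OF _ 0(2)[of n]] by simp
  then obtain K where K: "degree K \<le> card (B n)"
    "\<And>c. (\<Sum>u\<in>cube_slice n c. prod u (B n)) = poly K c * card (cube_slice n c)"
    using cube_slice_character_poly[of "card (B n)" n] 0(2)[of n] by blast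
  show ?case
  proof (intro exI[of _ K] conjI allI impI)
    fix c assume "reachable n 0 c"
    then have "card (cube_slice n c) \<noteq> 0" using cube_slice_nonempty by simp
    then show "row_sum n 0 c (\<lambda>x. \<Prod>i=n-0..n. prod (x i) (B i)) = poly K c" using K(2) by simp
  qed (use K in simp)
next
  case (Suc r)
  define k where "k = n - Suc r"
  have k: "n - r = Suc k" "k \<le> n" using Suc.prems(1) by (auto simp: k_def)
  have int: "{k..n} = insert k {Suc k..n}" using k by auto
  have sum_int: "(\<Sum>i=k..n. card (B i)) = card (B k) + (\<Sum>i=Suc k..n. card (B i))"
    unfolding int by simp
  obtain Q where Q: "degree Q \<le> (\<Sum>i=Suc k..n. card (B i))"
    "\<And>c. reachable n r c \<Longrightarrow> row_sum n r c (\<lambda>x. \<Prod>i=Suc k..n. prod (x i) (B i)) = poly Q c"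
    using Suc.IH Suc.prems unfolding k k_def[symmetric] sum_int by auto
  obtain s where s: "\<And>u. prod (balanced_row n u) (B k) = s * prod u (B k \<inter> {1..n-2})"
    using prod_balanced_row[OF Suc.prems(2)] by blast
  let ?I = "{1..n-2}"
  let ?B = "B k \<inter> ?I"
  define P where "P = (\<Sum>u\<in>sign_cube ?I. smult (s * prod u ?B) (Q \<circ>\<^sub>p [:- sum u ?I / 2, 1/2:]))"
  have "degree P \<le> degree Q"
    unfolding P_def by (intro degree_sum_le) (auto simp: degree_pcompose intro: order.trans[OF degree_smult_le])
  moreover have "row_sum n (Suc r) c (\<lambda>x. \<Prod>i=k..n. prod (x i) (B i)) = poly P c"
    if c: "reachable n (Suc r) c" for c
  proof -
    have prod_upd: "(\<Prod>i=k..n. prod ((x(k := v)) i) (B i)) = prod v (B k) * (\<Prod>i=Suc k..n. prod (x i) (B i))" for x v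
      unfolding int by simp
    have "row_sum n (Suc r) c (\<lambda>x. \<Prod>i=k..n. prod (x i) (B i)) =
      (\<Sum>u\<in>sign_cube ?I. (1 + row_sign n c * prod u ?I) * (s * prod u ?B *
          row_sum n r ((c - sum u ?I) / 2) (\<lambda>x. \<Prod>i=Suc k..n. prod (x i) (B i))))"
      unfolding row_sum.simps k_def[symmetric] prod_upd row_sum_mult s ..
    also have "\<dots> = (\<Sum>u\<in>sign_cube ?I. (1 + row_sign n c * prod u ?I) * (s * prod u ?B * poly Q ((c - sum u ?I) / 2)))"
    proof (rule sum.cong[OF refl])
      fix u assume "u \<in> sign_cube ?I"
      from row_weight[OF n c this] Q(2)
      show "(1 + row_sign n c * prod u ?I) * (s * prod u ?B * row_sum n r ((c - sum u ?I) / 2) (\<lambda>x. \<Prod>i=Suc k..n. prod (x i) (B i)))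
        = (1 + row_sign n c * prod u ?I) * (s * prod u ?B * poly Q ((c - sum u ?I) / 2))"
        by auto
    qed
    \<comment> \<open>The first sum is a polynomial in c. The second carries
      \<open>row_sign n c\<close>, which depends on c modulo 4, so it has to vanish.\<close>
    also have "\<dots> = (\<Sum>u\<in>sign_cube ?I. s * prod u ?B * poly Q ((c - sum u ?I) / 2)) +
        row_sign n c * s * (\<Sum>u\<in>sign_cube ?I. (prod u ?I * prod u ?B) * poly Q ((c - sum u ?I) / 2))"
      by (simp add: sum_distrib_left algebra_simps sum.distrib)
    also have "(\<Sum>u\<in>sign_cube ?I. (prod u ?I * prod u ?B) * poly Q ((c - sum u ?I) / 2))
        = (\<Sum>u\<in>sign_cube ?I. prod u (?I - ?B) * poly (Q \<circ>\<^sub>p [:c/2, -1/2:]) (sum u ?I))"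
    proof (rule sum.cong[OF refl])
      fix u assume u: "u \<in> sign_cube ?I"
      have "prod u ?I = prod u (?I - ?B) * prod u ?B" by (rule prod.subset_diff) auto
      moreover have "prod u ?B * prod u ?B = 1"
        unfolding prod.distrib[symmetric] using sign_cube_square[OF u] by (intro prod.neutral) auto
      ultimately have "prod u ?I * prod u ?B = prod u (?I - ?B)" by (simp add: mult.assoc)
      moreover have "poly (Q \<circ>\<^sub>p [:c/2, -1/2:]) (sum u ?I) = poly Q ((c - sum u ?I) / 2)"
        by (simp add: poly_pcompose diff_divide_distrib)
      ultimately show "(prod u ?I * prod u ?B) * poly Q ((c - sum u ?I) / 2)
        = prod u (?I - ?B) * poly (Q \<circ>\<^sub>p [:c/2, -1/2:]) (sum u ?I)" by simp
    qed
    also have "\<dots> = 0"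
    \<comment> \<open>The complementary character has n - 2 - card ?B elements, more than the degree
      of \<open>Q\<close>, since all the sets \<open>B i\<close> together have fewer than n - 2
      elements.\<close>
    proof (rule sum_character_poly_eq_0)
      have "finite (B k)" using Suc.prems(2) finite_subset by blast
      then have "card ?B \<le> card (B k)" by (intro card_mono) auto
      moreover have "card (?I - ?B) = n - 2 - card ?B" by (subst card_Diff_subset) auto
      ultimately show "degree (Q \<circ>\<^sub>p [:c/2, -1/2:]) < card (?I - ?B)"
        using Q(1) Suc.prems(3) unfolding k_def[symmetric] sum_int by (simp add: degree_pcompose)
    qed auto
    also have "(\<Sum>u\<in>sign_cube ?I. s * prod u ?B * poly Q ((c - sum u ?I) / 2)) = poly P c"
      by (simp add: P_def poly_sum poly_pcompose diff_divide_distrib)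
    finally show ?thesis by simp
  qed
  ultimately show ?case
    using Q(1) unfolding k_def[symmetric] sum_int by (intro exI[of _ P]) auto
qed

section \<open>Sign-representing polynomials\<close>

lemma mpoly_eval_add: "mpoly_eval (p + q) z = mpoly_eval p z + mpoly_eval q z"
  unfolding mpoly_eval_def by (rule setsum_keys_plus_distrib) (auto simp: algebra_simps)

lemma mpoly_eval_single:
  "mpoly_eval (Poly_Mapping.single m a) z = a * (\<Prod>v\<in>Poly_Mapping.keys m. z v ^ Poly_Mapping.lookup m v)"
  by (simp add: mpoly_eval_def)

lemma mpoly_eval_sum: "finite A \<Longrightarrow> mpoly_eval (sum f A) z = (\<Sum>a\<in>A. mpoly_eval (f a) z)"
  by (induction A rule: finite_induct) (simp_all add: mpoly_eval_add, simp add: mpoly_eval_def)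

lemma mpoly_vars_add: "mpoly_vars (p + q) \<subseteq> mpoly_vars p \<union> mpoly_vars q"
  unfolding mpoly_vars_def using keys_add[of p q] by blast

lemma mpoly_vars_sum:
  assumes "finite A" "\<And>a. a \<in> A \<Longrightarrow> mpoly_vars (f a) \<subseteq> I"
  shows "mpoly_vars (sum f A) \<subseteq> I"
  using assms
proof (induction A rule: finite_induct)
  case (insert a A)
  then have "mpoly_vars (f a) \<subseteq> I" "mpoly_vars (sum f A) \<subseteq> I" by auto
  then show ?case
    using insert.hyps mpoly_vars_add[of "f a" "sum f A"] by auto
qed (simp add: mpoly_vars_def)

section \<open>Fourier expansion on the cube\<close>

definition squarefree_monom :: "'v set \<Rightarrow> 'v \<Rightarrow>\<^sub>0 nat" where
  "squarefree_monom A = (\<Sum>v\<in>A. Poly_Mapping.single v 1)"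

lemma lookup_squarefree_monom:
  "finite A \<Longrightarrow> Poly_Mapping.lookup (squarefree_monom A) v = (if v \<in> A then 1 else 0)"
  by (simp add: squarefree_monom_def lookup_sum lookup_single when_def)

lemma keys_squarefree_monom: "finite A \<Longrightarrow> Poly_Mapping.keys (squarefree_monom A) = A"
  by (auto simp: in_keys_iff lookup_squarefree_monom split: if_splits)

lemma prod_one_plus_sign_cube:
  assumes "finite I" "z \<in> sign_cube I" "w \<in> sign_cube I"
  shows "(\<Prod>v\<in>I. 1 + w v * z v) = (if w = z then 2 ^ card I else 0)"
proof (cases "w = z")
  case True
  then have "(\<Prod>v\<in>I. 1 + w v * z v) = (\<Prod>v\<in>I. 2)"
    using sign_cube_square[OF assms(2)] by (intro prod.cong) auto
  then show ?thesis using True by simp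
next
  case False
  have "\<exists>v\<in>I. w v \<noteq> z v"
    using False assms unfolding sign_cube_def by (metis PiE_ext)
  then obtain v where v: "v \<in> I" "w v \<noteq> z v" by blast
  then have "1 + w v * z v = 0"
    using sign_cubeD[OF assms(2) v(1)] sign_cubeD[OF assms(3) v(1)] by auto
  then show ?thesis using False v assms by auto
qed

text \<open>Without this, the \<open>LEAST\<close> in the definition of the threshold degree could be over an empty set.\<close>

lemma sign_representation_exists:
  assumes fin: "finite I" and h: "\<And>z. z \<in> sign_cube I \<Longrightarrow> h z \<noteq> 0"
  shows "\<exists>p. sign_represents I p h"
proof -
  \<comment> \<open>These are the Fourier coefficients of h scaled by 2 ^ card I, so p takes the
    value 2 ^ card I * h z on the cube.\<close>
  define a where "a A = (\<Sum>w\<in>sign_cube I. h w * prod w A)" for A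
  define p where "p = (\<Sum>A\<in>Pow I. Poly_Mapping.single (squarefree_monom A) (a A))"
  have fins: "finite A" if "A \<in> Pow I" for A using that fin finite_subset by auto
  have "mpoly_vars p \<subseteq> I"
    unfolding p_def using fin fins
    by (intro mpoly_vars_sum) (auto simp: mpoly_vars_def keys_squarefree_monom)
  moreover have "h z * mpoly_eval p z > 0" if z: "z \<in> sign_cube I" for z
  proof -
    have "mpoly_eval p z = (\<Sum>A\<in>Pow I. a A * prod z A)"
      unfolding p_def using fin fins
      by (auto simp: mpoly_eval_sum mpoly_eval_single keys_squarefree_monom lookup_squarefree_monom
          intro!: sum.cong)
    also have "\<dots> = (\<Sum>A\<in>Pow I. \<Sum>w\<in>sign_cube I. h w * (\<Prod>v\<in>A. w v * z v))"
      by (simp add: a_def sum_distrib_right prod.distrib mult.assoc)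
    also have "\<dots> = (\<Sum>w\<in>sign_cube I. h w * (\<Sum>A\<in>Pow I. \<Prod>v\<in>A. w v * z v))"
      unfolding sum_distrib_left by (rule sum.swap)
    also have "\<dots> = (\<Sum>w\<in>sign_cube I. h w * (\<Prod>v\<in>I. w v * z v + 1))"
      using fin by (simp add: prod_add)
    also have "\<dots> = (\<Sum>w\<in>sign_cube I. if w = z then h w * 2 ^ card I else 0)"
      using fin z by (intro sum.cong) (auto simp: add.commute prod_one_plus_sign_cube)
    also have "\<dots> = h z * 2 ^ card I" using fin z by simp
    finally have "h z * mpoly_eval p z = (h z)\<^sup>2 * 2 ^ card I" by (simp add: power2_eq_square)
    then show ?thesis using h[OF z] by simp
  qed
  ultimately show ?thesis unfolding sign_represents_def by blast
qed

lemma threshold_degree_attained: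
  assumes "finite I" "\<And>z. z \<in> sign_cube I \<Longrightarrow> h z \<noteq> 0"
  obtains p where "sign_represents I p h" "total_degree p = threshold_degree I h"
proof -
  have "\<exists>d p. sign_represents I p h \<and> total_degree p = d"
    using sign_representation_exists[of I h] assms by blast
  then have "\<exists>p. sign_represents I p h \<and> total_degree p = threshold_degree I h"
    unfolding threshold_degree_def by (rule LeastI_ex)
  then show ?thesis using that by blast
qed

text \<open>Squares of coordinates are 1 on the cube, so a monomial restricts to the character of
  this set.\<close>

definition odd_part :: "('v \<Rightarrow>\<^sub>0 nat) \<Rightarrow> 'v set" where
  "odd_part m = {v. odd (Poly_Mapping.lookup m v)}"

lemma odd_part_subset: "odd_part m \<subseteq> Poly_Mapping.keys m"
proof
  fix v assume "v \<in> odd_part m"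
  then have "Poly_Mapping.lookup m v \<noteq> 0" by (auto simp: odd_part_def intro: ccontr)
  then show "v \<in> Poly_Mapping.keys m" by (simp add: in_keys_iff)
qed

lemma finite_odd_part [simp]: "finite (odd_part m)"
  by (rule finite_subset[OF odd_part_subset]) simp

lemma card_odd_part_le: "card (odd_part m) \<le> monom_degree m"
proof -
  have "card (odd_part m) = (\<Sum>v\<in>odd_part m. 1)" by simp
  also have "\<dots> \<le> (\<Sum>v\<in>odd_part m. Poly_Mapping.lookup m v)"
    by (intro sum_mono) (auto simp: odd_part_def Suc_le_eq odd_pos)
  also have "\<dots> \<le> monom_degree m"
    unfolding monom_degree_def by (intro sum_mono2 odd_part_subset) auto
  finally show ?thesis .
qed

lemma monom_on_sign_cube:
  assumes "z \<in> sign_cube I" "Poly_Mapping.keys m \<subseteq> I"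
  shows "(\<Prod>v\<in>Poly_Mapping.keys m. z v ^ Poly_Mapping.lookup m v) = prod z (odd_part m)"
proof -
  have "z v ^ Poly_Mapping.lookup m v = (if v \<in> odd_part m then z v else 1)" if "v \<in> Poly_Mapping.keys m" for v
    using sign_cubeD[OF assms(1) subsetD[OF assms(2) that]] by (auto simp: odd_part_def)
  then have "(\<Prod>v\<in>Poly_Mapping.keys m. z v ^ Poly_Mapping.lookup m v)
      = (\<Prod>v\<in>Poly_Mapping.keys m. if v \<in> odd_part m then z v else 1)" by simp
  also have "\<dots> = prod z (Poly_Mapping.keys m \<inter> odd_part m)"
    by (simp add: prod.inter_restrict)
  also have "Poly_Mapping.keys m \<inter> odd_part m = odd_part m"
    by (rule Int_absorb1[OF odd_part_subset])
  finally show ?thesis .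
qed

section \<open>The lower bound\<close>

definition grid_point :: "nat \<Rightarrow> (nat \<Rightarrow> nat \<Rightarrow> real) \<Rightarrow> nat \<times> nat \<Rightarrow> real" where
  "grid_point n x = (\<lambda>v\<in>grid n. x (fst v) (snd v))"

lemma grid_point_sign_cube:
  assumes "row_config n (n - 1) c x" "n \<ge> 1"
  shows "grid_point n x \<in> sign_cube (grid n)"
proof -
  have "x i j = -1 \<or> x i j = 1" if "i \<in> {1..n}" "j \<in> {1..n}" for i j
    using assms that by (intro sign_cubeD[where I = "{1..n}"]) (auto simp: row_config_def)
  then have "x (fst v) (snd v) = -1 \<or> x (fst v) (snd v) = 1" if "v \<in> grid n" for v
    using that by (simp add: grid_def mem_Times_iff)
  then show ?thesis by (auto simp: grid_point_def sign_cube_def)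
qed

text \<open>Row i has weight 2^i in the halfspace but 2^(i - 1) in \<open>row_config\<close>, hence
  the argument 1 + 2c.\<close>

lemma halfspace_grid_point:
  assumes "row_config n (n - 1) c x" "n \<ge> 1"
  shows "halfspace n (grid_point n x) = sgn (1 + 2 * c)"
proof -
  have "(\<Sum>i=1..n. \<Sum>j=1..n. 2 ^ i * grid_point n x (i, j)) = (\<Sum>i=1..n. 2 * (2 ^ (i - 1) * sum (x i) {1..n}))"
  proof (rule sum.cong[OF refl])
    fix i assume i: "i \<in> {1..n}"
    then have "(\<Sum>j=1..n. 2 ^ i * grid_point n x (i, j)) = (\<Sum>j=1..n. 2 ^ i * x i j)"
      by (intro sum.cong) (auto simp: grid_point_def grid_def)
    also have "\<dots> = 2 ^ i * sum (x i) {1..n}" by (simp add: sum_distrib_left)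
    also have "\<dots> = 2 * (2 ^ (i - 1) * sum (x i) {1..n})" using i by (cases i) auto
    finally show "(\<Sum>j=1..n. 2 ^ i * grid_point n x (i, j)) = 2 * (2 ^ (i - 1) * sum (x i) {1..n})" .
  qed
  also have "\<dots> = 2 * (\<Sum>i=1..n. 2 ^ (i - 1) * sum (x i) {1..n})" by (rule sum_distrib_left[symmetric])
  also have "\<dots> = 2 * c" using assms by (simp add: row_config_def)
  finally show ?thesis by (simp add: halfspace_def)
qed

lemma prod_grid_point:
  assumes "A \<subseteq> grid n"
  shows "prod (grid_point n x) A = (\<Prod>i=1..n. prod (x i) {j. (i, j) \<in> A})"
    and "(\<Sum>i=1..n. card {j. (i, j) \<in> A}) = card A"
proof -
  define C where "C i = {j. (i, j) \<in> A}" for i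
  have A: "A = Sigma {1..n} C" using assms by (auto simp: grid_def C_def)
  have C: "C i \<subseteq> {1..n}" for i using assms by (auto simp: grid_def C_def)
  then have fin: "finite (C i)" for i using finite_subset by blast
  have "prod (grid_point n x) A = (\<Prod>(i, j)\<in>Sigma {1..n} C. grid_point n x (i, j))"
    unfolding A by (intro prod.cong) auto
  also have "\<dots> = (\<Prod>i=1..n. \<Prod>j\<in>C i. grid_point n x (i, j))"
    using fin by (intro prod.Sigma[symmetric]) auto
  also have "\<dots> = (\<Prod>i=1..n. prod (x i) (C i))"
    using assms by (intro prod.cong refl) (auto simp: grid_point_def C_def)
  finally show "prod (grid_point n x) A = (\<Prod>i=1..n. prod (x i) {j. (i, j) \<in> A})"
    unfolding C_def .
  have "card A = (\<Sum>i=1..n. card (C i))"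
    unfolding A using fin by (intro card_SigmaI) auto
  then show "(\<Sum>i=1..n. card {j. (i, j) \<in> A}) = card A" unfolding C_def by simp
qed

lemma grid_character_poly:
  assumes "n \<ge> 3" "A \<subseteq> grid n" "card A < n - 2"
  shows "\<exists>Q. degree Q \<le> card A \<and> (\<forall>c. reachable n (n - 1) c \<longrightarrow>
    row_sum n (n - 1) c (\<lambda>x. prod (grid_point n x) A) = poly Q c)"
proof -
  have 1: "n - (n - 1) = 1" using assms by simp
  have "{j. (i, j) \<in> A} \<subseteq> {1..n}" for i using assms by (auto simp: grid_def)
  from row_sum_character_poly[where r = "n - 1" and B = "\<lambda>i. {j. (i, j) \<in> A}", OF assms(1) _ this]
  show ?thesis
    using assms unfolding 1 prod_grid_point[OF assms(2)] by simp
qed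

text \<open>Powers of 81 are odd, so \<open>\<tau>\<close> supplies the parity of n. Since 81 < 128
  = 2^7 and j \<le> 2d, the points are at most 2 * 2^(14d) \<le> 2^n.\<close>

lemma reachable_scaled_powers:
  assumes n: "14 * d + 1 \<le> n" and j: "j \<le> 2 * d"
  defines "\<tau> \<equiv> if even n then 2 else 1 :: real"
  shows "reachable n (n - 1) (\<tau> * 81 ^ j)" "reachable n (n - 1) (\<tau> * - (81 ^ j))" "1 \<le> \<tau> * 81 ^ j"
proof -
  define t :: int where "t = (if even n then 2 else 1)"
  have t: "\<tau> = of_int t" by (simp add: \<tau>_def t_def)
  have par: "even (t * 81 ^ j - int n)" "even (- (t * 81 ^ j) - int n)" by (auto simp: t_def)
  have "\<tau> * 81 ^ j \<le> 2 * 128 ^ (2 * d)"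
  proof (rule mult_mono)
    have "(81::real) ^ j \<le> 128 ^ j" by (rule power_mono) auto
    also have "\<dots> \<le> 128 ^ (2 * d)" using j by (intro power_increasing) auto
    finally show "(81::real) ^ j \<le> 128 ^ (2 * d)" .
  qed (auto simp: \<tau>_def)
  also have "\<dots> = 2 ^ (14 * d + 1)"
    using power_mult[of "2::real" 7 "2 * d"] by simp
  also have "\<dots> \<le> (2::real) ^ n" using n by (intro power_increasing) auto
  finally have "\<tau> * 81 ^ j \<le> 2 ^ n" .
  moreover show pos: "1 \<le> \<tau> * 81 ^ j"
    using mult_mono[of 1 \<tau> 1 "81 ^ j"] by (simp add: \<tau>_def)
  moreover have "n - 1 + 1 = n" "n \<ge> 1" using n by auto
  \<comment> \<open>For n = 1 the term n - 2 is negative; then d = j = 0 and the point 1 meets the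
    bound with equality.\<close>
  moreover have "2 \<le> n \<or> n = 1" using \<open>n \<ge> 1\<close> by linarith
  moreover have "real n - 2 \<ge> 0" if "2 \<le> n" using that by simp
  ultimately have bound: "\<bar>\<tau> * 81 ^ j\<bar> \<le> 2 ^ (n - 1 + 1) + real n - 2"
    using n j by (auto simp: \<tau>_def)
  have "\<exists>k::int. \<tau> * 81 ^ j = real n + 2 * of_int k"
  proof -
    from par(1) obtain k where "t * 81 ^ j - int n = 2 * k" by blast
    then have "of_int (t * 81 ^ j) = (of_int (int n + 2 * k) :: real)" by (simp only: of_int_eq_iff)
    then show ?thesis unfolding t by auto
  qed
  then show "reachable n (n - 1) (\<tau> * 81 ^ j)" using bound by (simp add: reachable_def)
  have "\<exists>k::int. \<tau> * - (81 ^ j) = real n + 2 * of_int k"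
  proof -
    from par(2) obtain k where "- (t * 81 ^ j) - int n = 2 * k" by blast
    then have "of_int (- (t * 81 ^ j)) = (of_int (int n + 2 * k) :: real)" by (simp only: of_int_eq_iff)
    then show ?thesis unfolding t by auto
  qed
  then show "reachable n (n - 1) (\<tau> * - (81 ^ j))" using bound by (simp add: reachable_def)
qed

lemma conj_halfspaces_degree:
  assumes d: "1 \<le> d" and n: "14 * d + 1 \<le> n"
    and p: "sign_represents (grid n <+> grid n) p (conj_copies (halfspace n) (halfspace n))"
  shows "d < total_degree p"
proof (rule ccontr)
  assume "\<not> d < total_degree p"
  then have deg: "total_degree p \<le> d" by simp
  let ?M = "Poly_Mapping.keys p"
  let ?R = "row_sum n (n - 1)"
  let ?g = "grid_point n"
  \<comment> \<open>The character of a monomial splits into a part in x and a part in y, which are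
    averaged independently.\<close>
  define A1 where "A1 m = {v. Inl v \<in> odd_part m}" for m :: "(nat \<times> nat) + (nat \<times> nat) \<Rightarrow>\<^sub>0 nat"
  define A2 where "A2 m = {v. Inr v \<in> odd_part m}" for m :: "(nat \<times> nat) + (nat \<times> nat) \<Rightarrow>\<^sub>0 nat"
  have keys: "Poly_Mapping.keys m \<subseteq> grid n <+> grid n" if "m \<in> ?M" for m
    using p that by (auto simp: sign_represents_def mpoly_vars_def)
  have odd: "odd_part m = A1 m <+> A2 m" for m
  proof (rule set_eqI)
    show "v \<in> odd_part m \<longleftrightarrow> v \<in> A1 m <+> A2 m" for v by (cases v) (auto simp: A1_def A2_def)
  qed
  have A_sub: "A1 m \<subseteq> grid n" "A2 m \<subseteq> grid n" if "m \<in> ?M" for m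
    using keys[OF that] odd_part_subset[of m] by (auto simp: A1_def A2_def)
  have finA: "finite (A1 m)" "finite (A2 m)" for m
    using finite_odd_part[of m] unfolding odd by (simp_all add: finite_Plus_iff)
  have A_card: "card (A1 m) \<le> d" "card (A2 m) \<le> d" if "m \<in> ?M" for m
  proof -
    have "monom_degree m \<le> total_degree p"
      unfolding total_degree_def using that by (intro Max_ge) auto
    then have "card (A1 m <+> A2 m) \<le> d" using card_odd_part_le[of m] deg unfolding odd by linarith
    then show "card (A1 m) \<le> d" "card (A2 m) \<le> d" using finA by (simp_all add: card_Plus)
  qed
  have n3: "n \<ge> 3" and dn: "d < n - 2" using n d by auto
  have Q_ex: "\<exists>Q. degree Q \<le> d \<and> (\<forall>c. reachable n (n - 1) c \<longrightarrow> ?R c (\<lambda>x. prod (?g x) A) = poly Q c)"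
    if A: "A \<subseteq> grid n" "card A \<le> d" for A
  proof -
    have "card A < n - 2" using A(2) dn by simp
    from grid_character_poly[OF n3 A(1) this] obtain Q where "degree Q \<le> card A"
      "\<forall>c. reachable n (n - 1) c \<longrightarrow> ?R c (\<lambda>x. prod (?g x) A) = poly Q c" by blast
    with A(2) show ?thesis by (intro exI[of _ Q]) auto
  qed
  have "\<forall>m\<in>?M. \<exists>Q. degree Q \<le> d \<and>
      (\<forall>c. reachable n (n - 1) c \<longrightarrow> ?R c (\<lambda>x. prod (?g x) (A1 m)) = poly Q c)"
    using Q_ex A_sub A_card by simp
  from bchoice[OF this] obtain Q1 where Q1: "\<And>m. m \<in> ?M \<Longrightarrow> degree (Q1 m) \<le> d"
    "\<And>m c. m \<in> ?M \<Longrightarrow> reachable n (n - 1) c \<Longrightarrow> ?R c (\<lambda>x. prod (?g x) (A1 m)) = poly (Q1 m) c"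
    by blast
  have "\<forall>m\<in>?M. \<exists>Q. degree Q \<le> d \<and>
      (\<forall>c. reachable n (n - 1) c \<longrightarrow> ?R c (\<lambda>x. prod (?g x) (A2 m)) = poly Q c)"
    using Q_ex A_sub A_card by simp
  from bchoice[OF this] obtain Q2 where Q2: "\<And>m. m \<in> ?M \<Longrightarrow> degree (Q2 m) \<le> d"
    "\<And>m c. m \<in> ?M \<Longrightarrow> reachable n (n - 1) c \<Longrightarrow> ?R c (\<lambda>x. prod (?g x) (A2 m)) = poly (Q2 m) c"
    by blast
  \<comment> \<open>The weighted sum of the rows always has the parity of \<open>n\<close>.\<close>
  define \<tau> :: real where "\<tau> = (if even n then 2 else 1)"
  define S :: "real set" where "S = (\<lambda>j. 81 ^ j) ` {..2*d} \<union> (\<lambda>j. - (81 ^ j)) ` {..2*d}"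
  let ?a = "Poly_Mapping.lookup p"
  \<comment> \<open>The two sections of P(s, t), the sum over the monomials m of a_m Q1_m(\<tau> s)
    Q2_m(\<tau> t).\<close>
  define F where "F t = (\<Sum>m\<in>?M. smult (?a m * poly (Q2 m) (\<tau> * t)) (Q1 m \<circ>\<^sub>p [:0, \<tau>:]))" for t
  define G where "G s = (\<Sum>m\<in>?M. smult (?a m * poly (Q1 m) (\<tau> * s)) (Q2 m \<circ>\<^sub>p [:0, \<tau>:]))" for s
  have \<tau>: "\<tau> > 0" by (simp add: \<tau>_def)
  \<comment> \<open>The distance of at least 1 from zero ensures that 1 + 2 \<tau> s has the sign of
    s.\<close>
  have S: "reachable n (n - 1) (\<tau> * s) \<and> (1 \<le> \<tau> * s \<and> 0 < s \<or> \<tau> * s \<le> -1 \<and> s < 0)" if "s \<in> S" for s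
    using that reachable_scaled_powers[OF n, folded \<tau>_def] by (auto simp: S_def)
  define \<Phi> where "\<Phi> x y = (\<Sum>m\<in>?M. (?a m * prod (?g x) (A1 m)) * prod (?g y) (A2 m))" for x y
  have F_eq: "poly (F t) s = ?R (\<tau> * s) (\<lambda>x. ?R (\<tau> * t) (\<lambda>y. \<Phi> x y))" if "s \<in> S" "t \<in> S" for s t
  proof -
    have "?R (\<tau> * t) (\<lambda>y. \<Phi> x y) = (\<Sum>m\<in>?M. (?a m * poly (Q2 m) (\<tau> * t)) * prod (?g x) (A1 m))" for x
      unfolding \<Phi>_def row_sum_linear 
      by (intro sum.cong refl) (simp only: Q2(2)[OF _ conjunct1[OF S[OF that(2)]]] mult_ac)
    then have "?R (\<tau> * s) (\<lambda>x. ?R (\<tau> * t) (\<lambda>y. \<Phi> x y))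
        = ?R (\<tau> * s) (\<lambda>x. \<Sum>m\<in>?M. (?a m * poly (Q2 m) (\<tau> * t)) * prod (?g x) (A1 m))"
      by (simp only:)
    also have "\<dots> = (\<Sum>m\<in>?M. (?a m * poly (Q2 m) (\<tau> * t)) * poly (Q1 m) (\<tau> * s))"
      unfolding row_sum_linear
      by (intro sum.cong refl) (simp only: Q1(2)[OF _ conjunct1[OF S[OF that(1)]]])
    also have "\<dots> = poly (F t) s"
      by (simp add: F_def poly_sum poly_pcompose mult_ac)
    finally show ?thesis ..
  qed
  \<comment> \<open>The conjunction is constant on all pairs of configurations with weighted sums
    \<tau> s and \<tau> t, so positive averaging keeps the sign of p.\<close>
  have sign: "0 < sign_and (sgn s) (sgn t) * poly (F t) s" if s: "s \<in> S" and t: "t \<in> S" for s t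
  proof -
    have "sign_and (sgn s) (sgn t) * poly (F t) s
        = ?R (\<tau> * s) (\<lambda>x. ?R (\<tau> * t) (\<lambda>y. sign_and (sgn s) (sgn t) * \<Phi> x y))"
      unfolding F_eq[OF s t] row_sum_mult ..
    also have "0 < \<dots>"
    proof (intro row_sum_pos)
      fix x y assume x: "row_config n (n - 1) (\<tau> * s) x" and y: "row_config n (n - 1) (\<tau> * t) y"
      define z where "z = case_sum (?g x) (?g y)"
      have z: "z \<in> sign_cube (grid n <+> grid n)"
        using grid_point_sign_cube[OF x] grid_point_sign_cube[OF y] n3
        by (auto simp: z_def sign_cube_def PiE_iff extensional_def split: sum.splits)
      have "mpoly_eval p z = (\<Sum>m\<in>?M. ?a m * prod z (odd_part m))"
        unfolding mpoly_eval_def using monom_on_sign_cube[OF z keys] by simp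
      also have "\<dots> = \<Phi> x y"
        unfolding \<Phi>_def odd using finA by (simp add: prod.Plus z_def mult.assoc)
      finally have eval: "mpoly_eval p z = \<Phi> x y" .
      have "halfspace n (?g x) = sgn s" "halfspace n (?g y) = sgn t"
        using halfspace_grid_point[OF x] halfspace_grid_point[OF y] S[OF s] S[OF t] n3 by auto
      then have "conj_copies (halfspace n) (halfspace n) z = sign_and (sgn s) (sgn t)"
        by (simp add: conj_copies_def z_def o_def)
      then show "0 < sign_and (sgn s) (sgn t) * \<Phi> x y"
        using p z eval by (auto simp: sign_represents_def)
    qed (use S[OF s] S[OF t] n3 in auto)
    finally show ?thesis .
  qed
  show False
  proof (rule no_bivariate_sign_representation[of d F G, folded S_def])
    show "degree (F t) \<le> d" "degree (G t) \<le> d" for t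
      unfolding F_def G_def using Q1(1) Q2(1) \<tau>
      by (auto intro!: degree_sum_le intro: order.trans[OF degree_smult_le] simp: degree_pcompose)
    show "poly (F t) s = poly (G s) t" for s t
      by (simp add: F_def G_def poly_sum poly_pcompose mult_ac)
  next
    fix s t assume "s \<in> S" "t \<in> S" "s < 0" "t < 0"
    then show "poly (F t) s < 0" using sign[of s t] by (simp add: sign_and_def)
  next
    fix s t assume "s \<in> S" "t \<in> S" "0 < s \<or> 0 < t"
    then show "0 < poly (F t) s" using sign[of s t] by (auto simp: sign_and_def)
  qed
qed

theorem theorem1p8:
  "(\<lambda>n. real (threshold_degree (grid n <+> grid n) (conj_copies (halfspace n) (halfspace n))))
     \<in> \<Omega>(\<lambda>n. real n)"
proof (rule landau_omega.bigI)
  show "eventually (\<lambda>n. norm (real (threshold_degree (grid n <+> grid n) (conj_copies (halfspace n) (halfspace n))))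
      \<ge> 1/14 * norm (real n)) sequentially"
    using eventually_ge_at_top[of 15]
  proof eventually_elim
    case (elim n)
    \<comment> \<open>The largest d with 14d + 1 \<le> n; it is positive because n \<ge> 15.
      Maximality gives n \<le> 14 (d + 1), whence the constant 1/14.\<close>
    define d where "d = (n - 1) div 14"
    have d: "1 \<le> d" "14 * d + 1 \<le> n" "n \<le> 14 * (d + 1)" using elim by (auto simp: d_def)
    define T where "T = threshold_degree (grid n <+> grid n) (conj_copies (halfspace n) (halfspace n))"
    obtain p where p: "sign_represents (grid n <+> grid n) p (conj_copies (halfspace n) (halfspace n))"
      "total_degree p = T"
      unfolding T_def
    proof (rule threshold_degree_attained)
      show "finite (grid n <+> grid n)" by (simp add: grid_def)
      show "conj_copies (halfspace n) (halfspace n) z \<noteq> 0" for z by (simp add: conj_copies_def sign_and_def)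
    qed
    have "d + 1 \<le> T"
      using conj_halfspaces_degree[OF d(1,2) p(1)] p(2) by simp
    then have "14 * (d + 1) \<le> 14 * T" by (rule mult_le_mono2)
    with d(3) have "n \<le> 14 * T" by (rule order.trans)
    then show ?case unfolding T_def[symmetric] by simp
  qed
qed simp

end
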